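(* Let $n \geq 5$ and let $s, t \in \{1, 2, \ldots, \lfloor \frac{n}{2}\rfloor\}$ with $s \neq t$ be such that $n \notin \{2s, 2t, 2(s+t)\}$ and ($3s = t$ or $3t = s$). Then each connected component of $\mathcal{N}(C_n(s,t))$ is homotopy equivalent to (A) $S^3$, if $3s = t$ and $n = 10s$ (or $3t = s$ and $n = 10t$); (B) $S^2 \vee S^2$, if $3s = t$ and $n = 12s$ (or $3t = s$ and $n = 12t$); (C) a wedge sum of circles, if $3s = t$ and $n \neq 8s, 10s, 12s$ (or $3t = s$ and $n \neq 8t, 10t, 12t$).
   Context: The circulant graph $C_n(s,t)$ is the simple graph with vertex set $\{1,2,\ldots,n\}$ in which two vertices $x,y$ are adjacent if and only if $x-y \pmod n$ lies in $\{s, t, n-s, n-t\}$. The neighborhood complex $\mathcal{N}(G)$ of a graph $G$ is the (abstract) simplicial complex whose vertices are all non-isolated vertices of $G$ and whose simplices are those subsets of $V(G)$ which have a common neighbor in $G$. Topological statements about a simplicial complex refer to its geometric realization. A wedge sum of circles means a wedge of at least one circle. *)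

theory Defs
  imports "HOL-Analysis.Analysis"
begin

section \<open>Circulant graphs and neighborhood complexes\<close>

text \<open>A graph is given by its vertex set and its adjacency relation; the relation below is
  guarded by membership in the vertex set.\<close>

definition circulant_verts :: "nat \<Rightarrow> nat set" where
  "circulant_verts n = {1..n}"

definition circulant_adj :: "nat \<Rightarrow> nat \<Rightarrow> nat \<Rightarrow> nat \<Rightarrow> nat \<Rightarrow> bool" where
  "circulant_adj n s t x y \<longleftrightarrow>
     x \<in> circulant_verts n \<and> y \<in> circulant_verts n \<and>
     (int x - int y) mod int n \<in> {int s, int t, int n - int s, int n - int t}"

lemma circulant_adj_irrefl:
  assumes "s \<in> {1..n div 2}" "t \<in> {1..n div 2}"
  shows "\<not> circulant_adj n s t x x"
  using assms by (auto simp: circulant_adj_def)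

lemma circulant_adj_sym:
  assumes "s \<in> {1..n div 2}" "t \<in> {1..n div 2}" "circulant_adj n s t x y"
  shows "circulant_adj n s t y x"
proof -
  have "(int y - int x) mod int n =
      (if (int x - int y) mod int n = 0 then 0 else int n - (int x - int y) mod int n)"
    using zmod_zminus1_eq_if[of "int x - int y" "int n"] by simp
  then show ?thesis
    using assms by (auto simp: circulant_adj_def)
qed

text \<open>Simplices of an abstract simplicial complex are nonempty finite sets. The vertices of the
  neighborhood complex are exactly the non-isolated vertices of the graph, because
  \<open>{v}\<close> has a common neighbor iff \<open>v\<close> has a neighbor.\<close>

definition neighborhood_complex :: "'a set \<Rightarrow> ('a \<Rightarrow> 'a \<Rightarrow> bool) \<Rightarrow> 'a set set" where
  "neighborhood_complex V adj =
     {\<sigma>. \<sigma> \<subseteq> V \<and> finite \<sigma> \<and> \<sigma> \<noteq> {} \<and> (\<exists>w\<in>V. \<forall>v\<in>\<sigma>. adj v w)}"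

section \<open>Geometric realization\<close>

text \<open>Points are given by barycentric coordinates. The topology is the one inherited from the
  product; for complexes with finitely many vertices, such as those considered here, it
  coincides with the coherent topology.\<close>

definition geometric_realization :: "'a set set \<Rightarrow> ('a \<Rightarrow> real) topology" where
  "geometric_realization K =
     subtopology (powertop_real UNIV)
       {x. (\<forall>v. 0 \<le> x v) \<and> {v. x v \<noteq> 0} \<in> K \<and> sum x {v. x v \<noteq> 0} = 1}"

section \<open>Wedge sums\<close>

definition quotient_topology :: "'a topology \<Rightarrow> ('a \<Rightarrow> 'b) \<Rightarrow> 'b topology" where
  "quotient_topology X f =
     topology (\<lambda>U. U \<subseteq> f ` topspace X \<and> openin X {x \<in> topspace X. f x \<in> U})"

lemma openin_quotient_topology:
  "openin (quotient_topology X f) U \<longleftrightarrow>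
     U \<subseteq> f ` topspace X \<and> openin X {x \<in> topspace X. f x \<in> U}"
proof -
  have 1: "{x \<in> topspace X. f x \<in> S \<inter> T} =
      {x \<in> topspace X. f x \<in> S} \<inter> {x \<in> topspace X. f x \<in> T}" for S T
    by auto
  have 2: "{x \<in> topspace X. f x \<in> \<Union>\<K>} = (\<Union>K\<in>\<K>. {x \<in> topspace X. f x \<in> K})" for \<K>
    by auto
  have "istopology (\<lambda>U. U \<subseteq> f ` topspace X \<and> openin X {x \<in> topspace X. f x \<in> U})"
    unfolding istopology_def 1 2 by blast
  then show ?thesis
    by (simp add: quotient_topology_def)
qed

lemma topspace_quotient_topology: "topspace (quotient_topology X f) = f ` topspace X"
proof
  show "topspace (quotient_topology X f) \<subseteq> f ` topspace X"
    by (meson openin_quotient_topology openin_topspace)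
  have "{x \<in> topspace X. f x \<in> f ` topspace X} = topspace X"
    by auto
  then show "f ` topspace X \<subseteq> topspace (quotient_topology X f)"
    by (metis openin_quotient_topology openin_subset openin_topspace order_refl)
qed

lemma quotient_map_quotient_topology: "quotient_map X (quotient_topology X f) f"
  by (auto simp: quotient_map_def topspace_quotient_topology openin_quotient_topology)

text \<open>The wedge of the pointed spaces \<open>(X i, p i)\<close> for \<open>i \<in> I\<close>: the quotient of their disjoint
  sum by the identification of all base points, which become the point \<open>None\<close>.\<close>

definition wedge_sum ::
    "('i \<Rightarrow> 'a topology) \<Rightarrow> ('i \<Rightarrow> 'a) \<Rightarrow> 'i set \<Rightarrow> ('i \<times> 'a) option topology" where
  "wedge_sum X p I =
     quotient_topology (sum_topology X I) (\<lambda>(i, x). if x = p i then None else Some (i, x))"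

definition nsphere_base :: "nat \<Rightarrow> real" where
  "nsphere_base = (\<lambda>i. if i = 0 then 1 else 0)"

lemma nsphere_base_in_nsphere: "nsphere_base \<in> topspace (nsphere d)"
  unfolding nsphere_base_def by (rule in_topspace_nsphere)

definition wedge_of_spheres :: "nat \<Rightarrow> nat \<Rightarrow> (nat \<times> (nat \<Rightarrow> real)) option topology" where
  "wedge_of_spheres d k = wedge_sum (\<lambda>_. nsphere d) (\<lambda>_. nsphere_base) {..<k}"

end

theory Submission
  imports Defs
begin

text \<open>By symmetry \<open>t = 3s\<close>, and then \<open>n > 6s\<close>. The neighbors of \<open>w\<close> are the four successive terms
  \<open>w - 3s, w - s, w + s, w + 3s\<close> of a progression with difference \<open>2s\<close>, so a component of the
  neighborhood complex is the complex on \<open>\<int>/m\<close> whose facets are the arcs of four consecutive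
  elements, where \<open>m\<close> is the order of \<open>2s\<close> modulo \<open>n\<close>; here \<open>m \<ge> 5\<close>, with \<open>m = 5\<close> iff \<open>n = 10s\<close> and
  \<open>m = 6\<close> iff \<open>n = 12s\<close>. For \<open>m = 5\<close> this is the boundary of the 4-simplex. For \<open>m \<ge> 7\<close> the arcs of
  four collapse to arcs of three and then to arcs of two elements, that is, to a cycle. For
  \<open>m = 6\<close> the complex collapses to the union of the boundaries of two tetrahedra sharing an
  edge, which an expansion and three collapses turn into two tetrahedron boundaries sharing a
  vertex.\<close>

section \<open>Collapses\<close>

text \<open>The value \<open>m = 6\<close> is exceptional because opposite elements modulo 6 are the
  ends of two different arcs of four, so that the end pairs cannot serve as collapsing faces; for
  \<open>m \<ge> 7\<close> an end pair determines its arc. A wedge glues at a point, while the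
  collapses for \<open>m = 6\<close> leave two tetrahedra sharing an edge; this is why an expansion
  by a new vertex intervenes there. The bounds on \<open>m\<close> come from writing
  \<open>n = m * g\<close> and \<open>2 * s = r * g\<close> with \<open>m\<close>, \<open>r\<close>
  coprime: \<open>6 * s < n\<close> becomes \<open>3 * r < m\<close>, so \<open>m \<le> 6\<close>
  forces \<open>r = 1\<close> and \<open>n = 2 * m * s\<close>. The value \<open>m = 4\<close> would
  mean \<open>n = 8 * s = 2 * (s + t)\<close>, which is excluded. A collapse here removes the whole
  open star of a face \<open>\<tau>\<close> as soon as a single vertex can be added to every simplex
  containing \<open>\<tau>\<close>. This asks for no free face and no sequence of elementary
  collapses, and one explicit deformation covers every use.\<close>

lemma powertop_real_eq_euclidean: "(powertop_real UNIV :: ('a \<Rightarrow> real) topology) = euclidean"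
  by (rule euclidean_product_topology)

definition bary_points :: "'a set set \<Rightarrow> ('a \<Rightarrow> real) set" where
  "bary_points K = {x. (\<forall>v. 0 \<le> x v) \<and> {v. x v \<noteq> 0} \<in> K \<and> sum x {v. x v \<noteq> 0} = 1}"

text \<open>Turns every realization into a set of functions with its subspace topology, to which
  \<open>continuous_on\<close>, \<open>connected\<close> and \<open>homotopic_with_canon\<close>
  apply.\<close>

lemma geometric_realization_eq: "geometric_realization K = top_of_set (bary_points K)"
  by (simp add: geometric_realization_def bary_points_def powertop_real_eq_euclidean)

lemma bary_pointsI:
  assumes "finite U" "\<And>v. v \<notin> U \<Longrightarrow> x v = 0" "\<And>v. 0 \<le> x v" "sum x U = 1" "{v. x v \<noteq> 0} \<in> K"
  shows "x \<in> bary_points K"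
proof -
  have "sum x {v. x v \<noteq> 0} = sum x U"
    using assms(1,2) by (intro sum.mono_neutral_left) auto
  then show ?thesis
    using assms by (simp add: bary_points_def)
qed

lemma bary_pointsD:
  assumes "x \<in> bary_points K"
  shows "0 \<le> x v" "{v. x v \<noteq> 0} \<in> K" "finite {v. x v \<noteq> 0}" "{v. x v \<noteq> 0} \<noteq> {}"
    and "sum x {v. x v \<noteq> 0} = 1"
proof -
  show 1: "sum x {v. x v \<noteq> 0} = 1" and "0 \<le> x v" "{v. x v \<noteq> 0} \<in> K"
    using assms by (auto simp: bary_points_def)
  show "finite {v. x v \<noteq> 0}"
    using 1 sum.infinite by fastforce
  show "{v. x v \<noteq> 0} \<noteq> {}"
    using 1 by force
qed

lemma sum_bary_points:
  assumes "x \<in> bary_points K" "finite U" "\<And>v. v \<notin> U \<Longrightarrow> x v = 0"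
  shows "sum x U = 1"
proof -
  have "sum x {v. x v \<noteq> 0} = sum x U"
    using assms(2,3) by (intro sum.mono_neutral_left) auto
  then show ?thesis
    using assms(1) by (simp add: bary_points_def)
qed

definition downset :: "'a set set \<Rightarrow> bool" where
  "downset K \<longleftrightarrow> (\<forall>\<sigma>\<in>K. \<forall>\<rho>\<subseteq>\<sigma>. \<rho> \<noteq> {} \<longrightarrow> \<rho> \<in> K)"

lemma downsetD: "downset K \<Longrightarrow> \<sigma> \<in> K \<Longrightarrow> \<rho> \<subseteq> \<sigma> \<Longrightarrow> \<rho> \<noteq> {} \<Longrightarrow> \<rho> \<in> K"
  by (auto simp: downset_def)

lemma continuous_on_Min_coordinates:
  assumes "finite T" "T \<noteq> {}"
  shows "continuous_on S (\<lambda>x :: 'a \<Rightarrow> real. Min (x ` T))"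
  using assms
proof (induction rule: finite_ne_induct)
  case (singleton a)
  then show ?case
    by (auto intro: continuous_on_subset[OF continuous_on_product_coordinates])
next
  case (insert a T)
  have "continuous_on S (\<lambda>x :: 'a \<Rightarrow> real. min (x a) (Min (x ` T)))"
    by (intro continuous_on_min insert)
      (auto intro: continuous_on_subset[OF continuous_on_product_coordinates])
  then show ?case
    using insert by simp
qed

text \<open>The straight-line deformation pushes the barycenter of \<open>\<tau>\<close> towards the apex \<open>v\<close> until a
  barycentric coordinate in \<open>\<tau>\<close> vanishes.\<close>

lemma homotopy_equivalent_space_collapse:
  fixes K :: "'a set set"
  assumes K: "downset K" and \<tau>: "finite \<tau>" "\<tau> \<noteq> {}" "v \<notin> \<tau>"
    and apex: "\<And>\<sigma>. \<sigma> \<in> K \<Longrightarrow> \<tau> \<subseteq> \<sigma> \<Longrightarrow> insert v \<sigma> \<in> K"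
  shows "geometric_realization K homotopy_equivalent_space
    geometric_realization {\<sigma> \<in> K. \<not> \<tau> \<subseteq> \<sigma>}"
proof -
  let ?K' = "{\<sigma> \<in> K. \<not> \<tau> \<subseteq> \<sigma>}"
  define \<mu> where "\<mu> x = Min (x ` \<tau>)" for x :: "'a \<Rightarrow> real"
  \<comment> \<open>Each coordinate in \<open>\<tau>\<close> gives up \<open>t * \<mu> x\<close> and
    \<open>v\<close> receives the total, so the sum stays 1. At \<open>t = 1\<close> a coordinate
    attaining the minimum vanishes. Points that already miss a vertex of \<open>\<tau>\<close> have
    \<open>\<mu> x = 0\<close> and never move.\<close>
  define h where "h t x = (\<lambda>w. x w - (if w \<in> \<tau> then t * \<mu> x else 0) +
    (if w = v then t * (real (card \<tau>) * \<mu> x) else 0))" for t and x :: "'a \<Rightarrow> real"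
  have \<mu>_le: "\<mu> x \<le> x w" if "w \<in> \<tau>" for x w
    using that \<tau> by (simp add: \<mu>_def)
  have \<mu>_attained: "\<exists>w\<in>\<tau>. x w = \<mu> x" for x
    using Min_in[of "x ` \<tau>"] \<tau> unfolding \<mu>_def by fastforce
  have \<mu>_nonneg: "0 \<le> \<mu> x" if "x \<in> bary_points K" for x
    using \<mu>_attained[of x] bary_pointsD(1)[OF that] by metis
  have \<mu>_0: "\<mu> x = 0" if "x \<in> bary_points K" "\<not> \<tau> \<subseteq> {w. x w \<noteq> 0}" for x
    using that(2) \<mu>_le[of _ x] \<mu>_nonneg[OF that(1)] by (force intro: antisym)
  have h_id: "h t x = x" if "\<mu> x = 0" for t x
    using that by (auto simp: h_def)
  have h_in: "h t x \<in> bary_points K" if x: "x \<in> bary_points K" and t: "0 \<le> t" "t \<le> 1" for t x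
  proof (cases "\<tau> \<subseteq> {w. x w \<noteq> 0}")
    case False
    then show ?thesis
      using \<mu>_0 h_id x by auto
  next
    case True
    let ?U = "insert v {w. x w \<noteq> 0}"
    note \<mu> = \<mu>_nonneg[OF x]
    have fin: "finite ?U"
      using bary_pointsD(3)[OF x] by simp
    have supp: "h t x w = 0" if "w \<notin> ?U" for w
      using that True by (auto simp: h_def)
    have nonneg: "0 \<le> h t x w" for w
    proof -
      have "t * \<mu> x \<le> x w" if "w \<in> \<tau>"
        using mult_right_mono[OF t(2) \<mu>] \<mu>_le[OF that, of x] by simp
      then show ?thesis
        using \<tau>(3) t(1) \<mu> bary_pointsD(1)[OF x, of w] by (auto simp: h_def)
    qed
    have "sum (h t x) ?U = sum x ?U - sum (\<lambda>w. if w \<in> \<tau> then t * \<mu> x else 0) ?U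
        + sum (\<lambda>w. if w = v then t * (real (card \<tau>) * \<mu> x) else 0) ?U"
      unfolding h_def by (simp only: sum.distrib sum_subtractf)
    also have "sum (\<lambda>w. if w = v then t * (real (card \<tau>) * \<mu> x) else 0) ?U = t * (real (card \<tau>) * \<mu> x)"
      using fin by simp
    also have "sum (\<lambda>w. if w \<in> \<tau> then t * \<mu> x else 0) ?U = sum (\<lambda>w. t * \<mu> x) (?U \<inter> \<tau>)"
      using fin by (simp only: sum.inter_restrict finite_insert)
    also have "?U \<inter> \<tau> = \<tau>"
      using True by auto
    also have "sum x ?U = 1"
      by (rule sum_bary_points[OF x fin]) auto
    finally have sum1: "sum (h t x) ?U = 1"
      by simp
    have "{w. h t x w \<noteq> 0} \<noteq> {}"
    proof
      assume "{w. h t x w \<noteq> 0} = {}"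
      then have "sum (h t x) ?U = 0"
        by (intro sum.neutral) auto
      with sum1 show False by simp
    qed
    moreover have "?U \<in> K"
      using apex True bary_pointsD(2)[OF x] by blast
    moreover have "{w. h t x w \<noteq> 0} \<subseteq> ?U"
      using supp by blast
    ultimately have "{w. h t x w \<noteq> 0} \<in> K"
      using downsetD[OF K] by blast
    with fin supp nonneg sum1 show ?thesis
      by (intro bary_pointsI)
  qed
  have in_K': "x \<in> bary_points ?K' \<longleftrightarrow> x \<in> bary_points K \<and> \<not> \<tau> \<subseteq> {w. x w \<noteq> 0}" for x
    by (auto simp: bary_points_def)
  have h1_in: "h 1 x \<in> bary_points ?K'" if x: "x \<in> bary_points K" for x
  proof -
    obtain w where "w \<in> \<tau>" "x w = \<mu> x"
      using \<mu>_attained by blast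
    then have "h 1 x w = 0"
      using \<tau>(3) by (auto simp: h_def)
    then show ?thesis
      using \<open>w \<in> \<tau>\<close> h_in[OF x, of 1] by (auto simp: in_K')
  qed
  have cont: "continuous_on S (\<lambda>p. h (fst p) (snd p))" for S
  proof (rule continuous_on_coordinatewise_then_product)
    fix w
    have snd: "continuous_on S (\<lambda>p. f (snd p))" if "continuous_on UNIV f" for f :: "('a \<Rightarrow> real) \<Rightarrow> real"
      by (rule continuous_on_compose2[OF that]) (auto intro: continuous_intros)
    have "continuous_on S (\<lambda>p. \<mu> (snd p))" "continuous_on S (\<lambda>p. snd p w)"
      unfolding \<mu>_def using \<tau> by (auto intro!: snd continuous_on_Min_coordinates)
    then show "continuous_on S (\<lambda>p. h (fst p) (snd p) w)"
      unfolding h_def by (cases "w \<in> \<tau>"; cases "w = v") (auto intro!: continuous_intros)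
  qed
  have cont1: "continuous_on S (h 1)" for S
    by (rule continuous_on_compose2[OF cont[of UNIV], of S "\<lambda>x. (1, x)", simplified])
      (auto intro: continuous_intros)
  have hom: "homotopic_with_canon (\<lambda>x. True) (bary_points K) (bary_points K) id (h 1)"
    unfolding homotopic_with_def
  proof (intro exI conjI ballI allI)
    show "continuous_map (prod_topology (top_of_set {0..1}) (top_of_set (bary_points K)))
        (top_of_set (bary_points K)) (\<lambda>p. h (fst p) (snd p))"
      using h_in by (auto simp: continuous_map_in_subtopology cont simp flip: subtopology_Times)
    show "h (fst (0, x)) (snd (0, x)) = id x" for x
      by (auto simp: h_def)
  qed auto
  show ?thesis
    unfolding geometric_realization_eq homotopy_equivalent_space_def
  proof (intro exI conjI)
    show "continuous_map (top_of_set (bary_points K)) (top_of_set (bary_points ?K')) (h 1)"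
      using h1_in cont1 by auto
    show "continuous_map (top_of_set (bary_points ?K')) (top_of_set (bary_points K)) id"
      by (auto simp: in_K')
    show "homotopic_with_canon (\<lambda>x. True) (bary_points K) (bary_points K) (id \<circ> h 1) id"
      using hom by (simp add: homotopic_with_sym)
    show "homotopic_with_canon (\<lambda>x. True) (bary_points ?K') (bary_points ?K') (h 1 \<circ> id) id"
    proof (rule homotopic_with_equal)
      show "continuous_map (top_of_set (bary_points ?K')) (top_of_set (bary_points ?K')) (h 1 \<circ> id)"
        using h1_in cont1 in_K' by auto
      show "(h 1 \<circ> id) x = id x" if "x \<in> topspace (top_of_set (bary_points ?K'))" for x
        using that h_id \<mu>_0 by (simp add: in_K')
    qed auto
  qed
qed

text \<open>No simplex contains two members of \<open>T\<close>, so their open stars are disjoint.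
  Inserting the apex into a simplex over one member therefore never leads into the star of another,
  and the stars can be removed one at a time.\<close>

lemma homotopy_equivalent_space_collapse_many:
  fixes K :: "'a set set"
  assumes K: "downset K" and "finite T"
    and T: "\<And>\<tau>. \<tau> \<in> T \<Longrightarrow> finite \<tau> \<and> \<tau> \<noteq> {} \<and>
      (\<exists>v. v \<notin> \<tau> \<and> (\<forall>\<sigma>\<in>K. \<tau> \<subseteq> \<sigma> \<longrightarrow> insert v \<sigma> \<in> K))"
    and disj: "\<And>\<tau> \<tau>' \<sigma>. \<tau> \<in> T \<Longrightarrow> \<tau>' \<in> T \<Longrightarrow> \<sigma> \<in> K \<Longrightarrow> \<tau> \<subseteq> \<sigma> \<Longrightarrow> \<tau>' \<subseteq> \<sigma> \<Longrightarrow> \<tau> = \<tau>'"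
  shows "geometric_realization K homotopy_equivalent_space
    geometric_realization {\<sigma> \<in> K. \<forall>\<tau>\<in>T. \<not> \<tau> \<subseteq> \<sigma>}"
  using \<open>finite T\<close> T disj
proof (induction rule: finite_induct)
  case empty
  then show ?case
    by (simp add: homotopy_equivalent_space_refl)
next
  case (insert \<tau> T)
  let ?K = "{\<sigma> \<in> K. \<forall>\<tau>\<in>T. \<not> \<tau> \<subseteq> \<sigma>}"
  obtain v where v: "v \<notin> \<tau>" "\<And>\<sigma>. \<sigma> \<in> K \<Longrightarrow> \<tau> \<subseteq> \<sigma> \<Longrightarrow> insert v \<sigma> \<in> K"
    using insert.prems(1)[of \<tau>] by auto
  have "geometric_realization ?K homotopy_equivalent_space
    geometric_realization {\<sigma> \<in> ?K. \<not> \<tau> \<subseteq> \<sigma>}"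
  proof (rule homotopy_equivalent_space_collapse[of _ _ v])
    show "downset ?K"
      using K unfolding downset_def by blast
    show "insert v \<sigma> \<in> ?K" if \<sigma>: "\<sigma> \<in> ?K" "\<tau> \<subseteq> \<sigma>" for \<sigma>
    proof -
      have "insert v \<sigma> \<in> K"
        using \<sigma> v by blast
      moreover have "\<not> \<tau>' \<subseteq> insert v \<sigma>" if "\<tau>' \<in> T" for \<tau>'
      proof
        assume "\<tau>' \<subseteq> insert v \<sigma>"
        then have "\<tau> = \<tau>'"
          using insert.prems(2)[of \<tau> \<tau>' "insert v \<sigma>"] that \<sigma>(2) \<open>insert v \<sigma> \<in> K\<close> by auto
        then show False
          using that \<open>\<tau> \<notin> T\<close> by simp
      qed
      ultimately show ?thesis
        by blast
    qed
  qed (use insert.prems v in auto)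
  moreover have "{\<sigma> \<in> ?K. \<not> \<tau> \<subseteq> \<sigma>} = {\<sigma> \<in> K. \<forall>\<tau>\<in>insert \<tau> T. \<not> \<tau> \<subseteq> \<sigma>}"
    by auto
  ultimately have *: "geometric_realization ?K homotopy_equivalent_space
    geometric_realization {\<sigma> \<in> K. \<forall>\<tau>\<in>insert \<tau> T. \<not> \<tau> \<subseteq> \<sigma>}"
    by (simp only:)
  have "geometric_realization K homotopy_equivalent_space geometric_realization ?K"
  proof (rule insert.IH)
    show "\<tau>' = \<tau>''" if "\<tau>' \<in> T" "\<tau>'' \<in> T" "\<sigma> \<in> K" "\<tau>' \<subseteq> \<sigma>" "\<tau>'' \<subseteq> \<sigma>" for \<tau>' \<tau>'' \<sigma>
      using insert.prems(2)[of \<tau>' \<tau>'' \<sigma>] that by simp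
  qed (use insert.prems(1) in simp)
  then show ?case
    using * by (rule homotopy_eqv_trans)
qed

section \<open>Boundaries of simplices and their wedges\<close>

lemma nsphere_eq_top_of_set:
  "nsphere d = top_of_set {x. (\<Sum>i\<le>d. x i ^ 2) = 1 \<and> (\<forall>i>d. x i = 0)}"
  by (simp add: nsphere powertop_real_eq_euclidean)

text \<open>Compactness passes on to wedges of spheres, where it turns a continuous bijection into a
  homeomorphism. The sphere lives among functions on all of \<open>nat\<close>, so it is treated as
  a closed subset of a cube that is compact by Tychonoff.\<close>

lemma compact_space_nsphere: "compact_space (nsphere d)"
proof -
  let ?B = "PiE UNIV (\<lambda>_ :: nat. {-1..1 :: real})"
  let ?S = "{x :: nat \<Rightarrow> real. (\<Sum>i\<le>d. x i ^ 2) = 1 \<and> (\<forall>i>d. x i = 0)}"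
  have "compactin (powertop_real UNIV) ?B"
    by (subst compactin_PiE) auto
  then have "compact ?B"
    by (simp add: powertop_real_eq_euclidean)
  moreover have "closed ?S"
    by (intro closed_Collect_conj closed_Collect_eq closed_Collect_all closed_Collect_imp)
      (auto intro!: continuous_intros)
  moreover have "?S \<subseteq> ?B"
  proof
    fix x assume x: "x \<in> ?S"
    have "\<bar>x i\<bar> \<le> 1" for i
    proof (cases "i \<le> d")
      case True
      then have "x i ^ 2 \<le> (\<Sum>i\<le>d. x i ^ 2)"
        by (intro member_le_sum) auto
      then show ?thesis
        using x by (simp add: abs_square_le_1)
    qed (use x in auto)
    then show "x \<in> ?B"
      by (auto simp: PiE_def abs_le_iff)
  qed
  ultimately have "compact ?S"
    using compact_Int_closed[of ?B ?S] by (simp add: Int_absorb1)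
  then show ?thesis
    by (simp add: nsphere_eq_top_of_set compact_space_subtopology)
qed

text \<open>A point \<open>z\<close> of the sphere, padded with the coordinate \<open>z (d + 1) = 0\<close>, is a
  representative of a line in the quotient of the coordinate space by the constant vectors; the
  boundary of the simplex contains the representative with minimum 0 and sum 1.\<close>

lemma nsphere_homeomorphic_simplex_boundary:
  fixes U :: "'a set"
  assumes U: "finite U" "card U = d + 2" "u \<in> U"
  obtains h where
    "homeomorphic_map (nsphere d) (geometric_realization {\<sigma>. \<sigma> \<noteq> {} \<and> \<sigma> \<subset> U}) h"
    "h nsphere_base = (\<lambda>w. if w = u then 1 else 0)"
proof -
  let ?L = "{\<sigma>. \<sigma> \<noteq> {} \<and> \<sigma> \<subset> U}"
  let ?I = "{..d + 1}"
  let ?S = "{x :: nat \<Rightarrow> real. (\<Sum>i\<le>d. x i ^ 2) = 1 \<and> (\<forall>i>d. x i = 0)}"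
  \<comment> \<open>The nonzero coordinate of \<open>nsphere_base\<close> has index 0, so the
    enumeration of \<open>U\<close> is made to start with \<open>u\<close>.\<close>
  obtain b where b: "bij_betw b ?I U" "b 0 = u"
  proof -
    obtain c where c: "bij_betw c ?I U"
      using finite_same_card_bij[of ?I U] U by auto
    then obtain j where j: "j \<in> ?I" "c j = u"
      using U(3) by (metis bij_betw_iff_bijections)
    have "bij_betw (c \<circ> Transposition.transpose 0 j) ?I U"
      by (rule bij_betw_trans[OF _ c]) (use j in simp)
    then show ?thesis
      using j that[of "c \<circ> Transposition.transpose 0 j"] by simp
  qed
  define a where "a = inv_into ?I b"
  have a_b: "a (b i) = i" if "i \<le> d + 1" for i
    unfolding a_def using that by (intro bij_betw_inv_into_left[OF b(1)]) auto
  have b_a: "b (a w) = w" "a w \<le> d + 1" if "w \<in> U" for w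
    using that bij_betw_inv_into_right[OF b(1) that] bij_betw_apply[OF bij_betw_inv_into[OF b(1)] that]
    by (auto simp: a_def)
  have b_in: "b i \<in> U" if "i \<le> d + 1" for i
    using that bij_betw_apply[OF b(1), of i] by auto
  have sum_U: "sum f U = (\<Sum>i\<le>d + 1. f (b i))" for f :: "'a \<Rightarrow> real"
    by (rule sum.reindex_bij_betw[OF b(1), symmetric])
  \<comment> \<open>\<open>h\<close> normalizes to minimum 0 and sum 1, \<open>k\<close> to last
    coordinate 0 and Euclidean norm 1. Both only translate by a constant and scale by a positive
    factor, hence they are inverse to each other.\<close>
  define m where "m z = Min (z ` ?I)" for z :: "nat \<Rightarrow> real"
  define s where "s z = (\<Sum>i\<le>d + 1. z i - m z)" for z :: "nat \<Rightarrow> real"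
  define h where "h z = (\<lambda>w. if w \<in> U then (z (a w) - m z) / s z else 0)" for z :: "nat \<Rightarrow> real"
  define r where "r x = sqrt (\<Sum>i\<le>d. (x (b i) - x (b (d + 1))) ^ 2)" for x :: "'a \<Rightarrow> real"
  define k where "k x = (\<lambda>i. if i \<le> d then (x (b i) - x (b (d + 1))) / r x else 0)" for x :: "'a \<Rightarrow> real"
  have m_le: "m z \<le> z i" if "i \<le> d + 1" for z i
    using that unfolding m_def by (intro Min_le) auto
  have m_attained: "\<exists>i\<le>d + 1. z i = m z" for z
    using Min_in[of "z ` ?I"] unfolding m_def by fastforce
  have mI: "m z = c" if "\<And>i. i \<le> d + 1 \<Longrightarrow> c \<le> z i" "\<exists>i\<le>d + 1. z i = c" for z c
    using that unfolding m_def by (intro Min_eqI) auto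
  have s_pos: "s z > 0" if z: "z \<in> ?S" for z
  proof (rule ccontr)
    assume "\<not> 0 < s z"
    moreover have "0 \<le> s z"
      unfolding s_def using m_le by (intro sum_nonneg) auto
    ultimately have "s z = 0"
      by simp
    then have "z i - m z = 0" if "i \<le> d + 1" for i
      using that m_le unfolding s_def by (subst (asm) sum_nonneg_eq_0_iff) auto
    then have eq: "z i = m z" if "i \<le> d + 1" for i
      using that by auto
    have "z (d + 1) = 0"
      using z by auto
    then have "z i = 0" if "i \<le> d" for i
      using eq[of i] eq[of "d + 1"] that by simp
    then show False
      using z by simp
  qed
  \<comment> \<open>If \<open>r x = 0\<close>, then \<open>x\<close> is constant on
    \<open>U\<close>. Its support is a proper subset of \<open>U\<close>, so the constant is 0,
    against nonemptiness of the support.\<close>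
  have r_pos: "r x > 0" if x: "x \<in> bary_points ?L" for x
  proof (rule ccontr)
    assume "\<not> 0 < r x"
    then have "r x = 0"
      using real_sqrt_ge_zero[of "\<Sum>i\<le>d. (x (b i) - x (b (d + 1))) ^ 2"]
      unfolding r_def by (simp add: sum_nonneg order.antisym)
    then have "(x (b i) - x (b (d + 1))) ^ 2 = 0" if "i \<le> d" for i
      using that unfolding r_def real_sqrt_eq_zero_cancel_iff by (subst (asm) sum_nonneg_eq_0_iff) auto
    then have eq: "x (b i) = x (b (d + 1))" if "i \<le> d + 1" for i
      using that by (cases "i = d + 1") (auto simp: le_Suc_eq)
    have U_eq: "x w = x (b (d + 1))" if "w \<in> U" for w
      using eq[of "a w"] b_a[OF that] by simp
    have "\<exists>w\<in>U. x w = 0"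
      using bary_pointsD(2)[OF x] by auto
    then have "x w = 0" if "w \<in> U" for w
      using U_eq that by metis
    then show False
      using bary_pointsD(2,4)[OF x] by auto
  qed
  have h_in: "h z \<in> bary_points ?L" if z: "z \<in> ?S" for z
  proof (rule bary_pointsI[OF U(1)])
    have "sum (h z) U = (\<Sum>i\<le>d + 1. (z i - m z) / s z)"
      unfolding sum_U by (rule sum.cong) (auto simp: h_def a_b b_in)
    also have "\<dots> = 1"
      using s_pos[OF z] by (simp add: s_def flip: sum_divide_distrib)
    finally show 1: "sum (h z) U = 1" .
    show "0 \<le> h z w" for w
      using s_pos[OF z] m_le b_a by (auto simp: h_def)
    obtain i where i: "i \<le> d + 1" "z i = m z"
      using m_attained by blast
    then have "h z (b i) = 0" "b i \<in> U"
      by (auto simp: h_def a_b b_in)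
    moreover have "{w. h z w \<noteq> 0} \<subseteq> U"
      by (auto simp: h_def)
    moreover have "{w. h z w \<noteq> 0} \<noteq> {}"
      using 1 by (force intro: sum.neutral)
    ultimately show "{w. h z w \<noteq> 0} \<in> ?L"
      by blast
  qed (auto simp: h_def)
  have k_in: "k x \<in> ?S" if x: "x \<in> bary_points ?L" for x
  proof -
    have "(\<Sum>i\<le>d. k x i ^ 2) = (\<Sum>i\<le>d. (x (b i) - x (b (d + 1))) ^ 2) / r x ^ 2"
      by (simp add: k_def power_divide sum_divide_distrib)
    also have "(\<Sum>i\<le>d. (x (b i) - x (b (d + 1))) ^ 2) = r x ^ 2"
      by (simp add: r_def sum_nonneg)
    finally show ?thesis
      using r_pos[OF x] by (simp add: k_def)
  qed
  have k_h: "k (h z) = z" if z: "z \<in> ?S" for z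
  proof -
    have "h z (b i) - h z (b (d + 1)) = z i / s z" if "i \<le> d" for i
      using z that by (simp add: h_def a_b b_in flip: add_divide_distrib)
    moreover from this have "r (h z) = 1 / s z"
      using z s_pos[OF z] by (simp add: r_def power_divide flip: sum_divide_distrib)
        (simp add: real_sqrt_divide)
    ultimately show ?thesis
      using z s_pos[OF z] by (auto simp: k_def)
  qed
  have h_k: "h (k x) = x" if x: "x \<in> bary_points ?L" for x
  proof -
    have k_eq: "k x i = (x (b i) - x (b (d + 1))) / r x" if "i \<le> d + 1" for i
      using that by (cases "i = d + 1") (auto simp: k_def)
    obtain i where i: "i \<le> d + 1" "x (b i) = 0"
      using bary_pointsD(2)[OF x] b_a by fastforce
    have m_eq: "m (k x) = - x (b (d + 1)) / r x"
    proof (rule mI)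
      show "- x (b (d + 1)) / r x \<le> k x j" if "j \<le> d + 1" for j
        unfolding k_eq[OF that] using r_pos[OF x] bary_pointsD(1)[OF x]
        by (intro divide_right_mono) auto
      show "\<exists>j\<le>d + 1. k x j = - x (b (d + 1)) / r x"
        using i k_eq[OF i(1)] by auto
    qed
    have *: "k x i - m (k x) = x (b i) / r x" if "i \<le> d + 1" for i
      by (simp add: k_eq[OF that] m_eq diff_divide_distrib)
    have "sum x U = 1"
      using sum_bary_points[OF x U(1)] bary_pointsD(2)[OF x] by auto
    then have "s (k x) = 1 / r x"
      unfolding s_def sum_U using * by (simp flip: sum_divide_distrib)
    then have "h (k x) w = x w" for w
      using * r_pos[OF x] b_a[of w] bary_pointsD(2)[OF x] by (auto simp: h_def)
    then show ?thesis
      by auto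
  qed
  have coord: "continuous_on S (\<lambda>x. x i)" for i and S :: "('i \<Rightarrow> real) set"
    by (rule continuous_on_subset[OF continuous_on_product_coordinates]) auto
  have cont_m: "continuous_on ?S m"
    unfolding m_def by (rule continuous_on_Min_coordinates) auto
  have cont_s: "continuous_on ?S s"
    unfolding s_def by (intro continuous_intros coord cont_m)
  have cont_h: "continuous_on ?S h"
  proof (rule continuous_on_coordinatewise_then_product)
    have "\<forall>z\<in>?S. s z \<noteq> 0"
      using s_pos by fastforce
    then show "continuous_on ?S (\<lambda>z. h z w)" for w
      unfolding h_def
      by (cases "w \<in> U") (simp_all add: continuous_on_divide continuous_on_diff coord cont_m cont_s)
  qed
  have cont_r: "continuous_on (bary_points ?L) r"
    unfolding r_def by (intro continuous_intros coord)
  have cont_k: "continuous_on (bary_points ?L) k"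
  proof (rule continuous_on_coordinatewise_then_product)
    have "\<forall>x\<in>bary_points ?L. r x \<noteq> 0"
      using r_pos by fastforce
    then show "continuous_on (bary_points ?L) (\<lambda>x. k x i)" for i
      unfolding k_def
      by (cases "i \<le> d") (simp_all add: continuous_on_divide continuous_on_diff coord cont_r)
  qed
  have "homeomorphic_maps (nsphere d) (geometric_realization ?L) h k"
    unfolding homeomorphic_maps_def nsphere_eq_top_of_set geometric_realization_eq
    using cont_h cont_k h_in k_in h_k k_h by auto
  then have "homeomorphic_map (nsphere d) (geometric_realization ?L) h"
    using homeomorphic_maps_map by blast
  moreover have "h nsphere_base = (\<lambda>w. if w = u then 1 else 0)"
  proof -
    \<comment> \<open>The minimum 0 is attained at index 1, which the padding coordinate
      \<open>d + 1\<close> makes available even for \<open>d = 0\<close>.\<close>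
    have "m nsphere_base = 0"
      by (rule mI) (auto simp: nsphere_base_def intro!: exI[of _ 1])
    moreover from this have "s nsphere_base = 1"
      by (simp add: s_def nsphere_base_def)
    moreover have "a w = 0 \<longleftrightarrow> w = u" if "w \<in> U" for w
      using that b(2) b_a[OF that] a_b[of 0] by auto
    ultimately show ?thesis
      using U(3) by (auto simp: h_def nsphere_base_def)
  qed
  ultimately show ?thesis
    using that by blast
qed

text \<open>All \<open>h i\<close> send the base point to the vertex \<open>v\<close>, so together
  they factor through the quotient as \<open>f\<close>. The subcomplexes share at most
  \<open>v\<close>, which makes \<open>f\<close> injective; a continuous bijection from a compact
  space to a Hausdorff space is a homeomorphism.\<close>

lemma wedge_of_spheres_homeomorphic:
  fixes L :: "nat \<Rightarrow> 'a set set"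
  assumes h: "\<And>i. i < k \<Longrightarrow> homeomorphic_map (nsphere d) (geometric_realization (L i)) (h i)"
    and base: "\<And>i. i < k \<Longrightarrow> h i nsphere_base = (\<lambda>w. if w = v then 1 else 0)"
    and inter: "\<And>i j. i < k \<Longrightarrow> j < k \<Longrightarrow> i \<noteq> j \<Longrightarrow> L i \<inter> L j \<subseteq> {{v}}"
  shows "geometric_realization (\<Union>i<k. L i) homeomorphic_space wedge_of_spheres d k"
proof -
  let ?K = "\<Union>i<k. L i"
  let ?X = "sum_topology (\<lambda>_. nsphere d) {..<k}"
  define q where "q = (\<lambda>(i :: nat, x). if x = nsphere_base then None else Some (i, x))"
  define e where "e = (\<lambda>w. if w = v then 1 else 0 :: real)"
  define f where "f y = (case y of None \<Rightarrow> e | Some (i, x) \<Rightarrow> h i x)" for y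
  have W: "wedge_of_spheres d k = quotient_topology ?X q"
    by (simp add: wedge_of_spheres_def wedge_sum_def q_def)
  have f_q: "f (q (i, x)) = h i x" if "i < k" for i x
    using base[OF that] by (simp add: f_def q_def e_def)
  have quot: "quotient_map ?X (wedge_of_spheres d k) q"
    unfolding W by (rule quotient_map_quotient_topology)
  have sub: "bary_points (L i) \<subseteq> bary_points ?K" if "i < k" for i
    using that by (auto simp: bary_points_def)
  have h_img: "h i ` topspace (nsphere d) = bary_points (L i)" if "i < k" for i
    using homeomorphic_imp_surjective_map[OF h[OF that]] by (simp add: geometric_realization_eq)
  have cont_h: "continuous_map (nsphere d) (geometric_realization ?K) (h i)" if "i < k" for i
    using homeomorphic_imp_continuous_map[OF h[OF that]] sub[OF that]
    by (auto simp: geometric_realization_eq continuous_map_in_subtopology)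
  have "continuous_map ?X (geometric_realization ?K) (f \<circ> q)"
    unfolding continuous_map_def
  proof (intro conjI allI impI)
    show "f \<circ> q \<in> topspace ?X \<rightarrow> topspace (geometric_realization ?K)"
      using cont_h by (auto simp: f_q continuous_map_def Pi_iff)
    fix V assume V: "openin (geometric_realization ?K) V"
    show "openin ?X {x \<in> topspace ?X. (f \<circ> q) x \<in> V}"
      unfolding openin_sum_topology
    proof (intro conjI ballI)
      fix i assume i: "i \<in> {..<k}"
      then have "{x. (i, x) \<in> {x \<in> topspace ?X. (f \<circ> q) x \<in> V}} = {x \<in> topspace (nsphere d). h i x \<in> V}"
        by (auto simp: f_q)
      then show "openin (nsphere d) {x. (i, x) \<in> {x \<in> topspace ?X. (f \<circ> q) x \<in> V}}"
        using openin_continuous_map_preimage[OF cont_h V] i by simp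
    qed auto
  qed
  then have "continuous_map (wedge_of_spheres d k) (geometric_realization ?K) f"
    using continuous_compose_quotient_map_eq[OF quot] by blast
  moreover have "compact_space (wedge_of_spheres d k)"
  proof -
    have "continuous_map (nsphere d) ?X (Pair i)" if "i < k" for i
      using that continuous_map_component_injection[of i "{..<k}" "\<lambda>_. nsphere d"] by simp
    then have "continuous_map (nsphere d) (wedge_of_spheres d k) (q \<circ> Pair i)" if "i < k" for i
      using that continuous_map_compose quotient_imp_continuous_map[OF quot] by blast
    then have "compactin (wedge_of_spheres d k) ((q \<circ> Pair i) ` topspace (nsphere d))" if "i < k" for i
      using that image_compactin compact_space_nsphere compact_space_def by metis
    then have "compactin (wedge_of_spheres d k) (\<Union>i<k. (q \<circ> Pair i) ` topspace (nsphere d))"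
      by (intro compactin_Union) auto
    also have "(\<Union>i<k. (q \<circ> Pair i) ` topspace (nsphere d)) = topspace (wedge_of_spheres d k)"
      unfolding W topspace_quotient_topology by force
    finally show ?thesis
      by (simp add: compact_space_def)
  qed
  moreover have "Hausdorff_space (geometric_realization ?K)"
    by (simp add: geometric_realization_def Hausdorff_space_subtopology Hausdorff_space_product_topology)
  moreover have top: "topspace (wedge_of_spheres d k) = q ` ({..<k} \<times> topspace (nsphere d))"
    unfolding W topspace_quotient_topology by (auto simp: Sigma_def)
  moreover have "f ` topspace (wedge_of_spheres d k) = topspace (geometric_realization ?K)"
  proof -
    have "f ` topspace (wedge_of_spheres d k) = (\<Union>i<k. h i ` topspace (nsphere d))"
      unfolding top image_image by (force simp: f_q)
    also have "\<dots> = (\<Union>i<k. bary_points (L i))"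
      using h_img by auto
    also have "\<dots> = bary_points ?K"
      by (auto simp: bary_points_def)
    finally show ?thesis
      by (simp add: geometric_realization_eq)
  qed
  moreover have "inj_on f (topspace (wedge_of_spheres d k))"
  proof -
    have inj: "inj_on (h i) (topspace (nsphere d))" if "i < k" for i
      using homeomorphic_imp_injective_map[OF h[OF that]] .
    have eq: "q (i, x) = q (j, y)"
      if i: "i < k" and j: "j < k" and x: "x \<in> topspace (nsphere d)" and y: "y \<in> topspace (nsphere d)"
        and hh: "h i x = h j y" for i j x y
    proof (cases "i = j")
      case True
      then show ?thesis
        using inj[OF i] x y hh by (auto dest: inj_onD)
    next
      case False
      \<comment> \<open>The support of the common image point is a simplex of both
        \<open>L i\<close> and \<open>L j\<close>, hence \<open>{v}\<close>. The point is thus the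
        vertex \<open>v\<close>, which \<open>h i\<close> and \<open>h j\<close> take only at the
        base point.\<close>
      have hi: "h i x \<in> bary_points (L i)" and hj: "h i x \<in> bary_points (L j)"
        using imageI[OF x, of "h i"] imageI[OF y, of "h j"] unfolding h_img[OF i] h_img[OF j] hh by auto
      have supp: "{w. h i x w \<noteq> 0} = {v}"
        using bary_pointsD(2)[OF hi] bary_pointsD(2)[OF hj] inter[OF i j False] by blast
      have "h i x v = 1"
        using bary_pointsD(5)[OF hi] unfolding supp by simp
      have e: "h i x = e"
      proof
        show "h i x w = e w" for w
          using supp \<open>h i x v = 1\<close> by (cases "w = v") (auto simp: e_def)
      qed
      have "x = nsphere_base"
        by (rule inj_onD[OF inj[OF i] _ x nsphere_base_in_nsphere]) (simp add: e base[OF i] e_def)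
      moreover have "y = nsphere_base"
        by (rule inj_onD[OF inj[OF j] _ y nsphere_base_in_nsphere])
          (simp add: e base[OF j] e_def flip: hh)
      ultimately show ?thesis
        by (simp add: q_def)
    qed
    show ?thesis
    proof (rule inj_onI)
      fix y z assume y: "y \<in> topspace (wedge_of_spheres d k)"
        and z: "z \<in> topspace (wedge_of_spheres d k)" and fyz: "f y = f z"
      obtain i x where i: "i < k" "x \<in> topspace (nsphere d)" "y = q (i, x)"
        using y unfolding top by blast
      obtain j x' where j: "j < k" "x' \<in> topspace (nsphere d)" "z = q (j, x')"
        using z unfolding top by blast
      have "h i x = h j x'"
        using fyz unfolding i(3) j(3) f_q[OF i(1)] f_q[OF j(1)] .
      then show "y = z"
        unfolding i(3) j(3) by (rule eq[OF i(1) j(1) i(2) j(2)])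
    qed
  qed
  ultimately have "homeomorphic_map (wedge_of_spheres d k) (geometric_realization ?K) f"
    by (intro continuous_imp_homeomorphic_map)
  then show ?thesis
    using homeomorphic_map_imp_homeomorphic_space homeomorphic_space_sym by blast
qed

section \<open>Complexes of arcs\<close>

definition facet_complex :: "'a set set \<Rightarrow> 'a set set" where
  "facet_complex \<F> = {\<sigma>. \<sigma> \<noteq> {} \<and> (\<exists>F\<in>\<F>. \<sigma> \<subseteq> F)}"

lemma facet_complexI: "F \<in> \<F> \<Longrightarrow> \<sigma> \<subseteq> F \<Longrightarrow> \<sigma> \<noteq> {} \<Longrightarrow> \<sigma> \<in> facet_complex \<F>"
  unfolding facet_complex_def by blast

lemma facet_complexE:
  assumes "\<sigma> \<in> facet_complex \<F>"
  obtains F where "F \<in> \<F>" "\<sigma> \<subseteq> F" "\<sigma> \<noteq> {}"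
  using assms unfolding facet_complex_def by blast

lemma downset_facet_complex: "downset (facet_complex \<F>)"
  unfolding downset_def
proof (intro ballI allI impI)
  fix \<sigma> \<rho> assume "\<sigma> \<in> facet_complex \<F>" and \<rho>: "\<rho> \<subseteq> \<sigma>" "\<rho> \<noteq> {}"
  then obtain F where "F \<in> \<F>" "\<sigma> \<subseteq> F"
    by (elim facet_complexE)
  then show "\<rho> \<in> facet_complex \<F>"
    using \<rho> by (intro facet_complexI[of F]) simp_all
qed

text \<open>Reduces a collapse to a finite check on generating sets. A face of \<open>F\<close> that
  does not contain \<open>\<tau>\<close> misses some \<open>w \<in> \<tau>\<close> and lies in
  \<open>F - {w}\<close>, so \<open>sup\<close> and \<open>bdry\<close> ensure that
  \<open>\<G>\<close> generates all that remains.\<close>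

lemma homotopy_equivalent_space_collapse_facet_complex:
  fixes \<F> :: "'a set set"
  assumes \<tau>: "finite \<tau>" "\<tau> \<noteq> {}" "v \<notin> \<tau>"
    and apex: "\<And>F. F \<in> \<F> \<Longrightarrow> \<tau> \<subseteq> F \<Longrightarrow> \<exists>F'\<in>\<F>. insert v F \<subseteq> F'"
    and sub: "\<And>G. G \<in> \<G> \<Longrightarrow> \<not> \<tau> \<subseteq> G \<and> (\<exists>F\<in>\<F>. G \<subseteq> F)"
    and sup: "\<And>F. F \<in> \<F> \<Longrightarrow> \<not> \<tau> \<subseteq> F \<Longrightarrow> \<exists>G\<in>\<G>. F \<subseteq> G"
    and bdry: "\<And>F w. F \<in> \<F> \<Longrightarrow> \<tau> \<subseteq> F \<Longrightarrow> w \<in> \<tau> \<Longrightarrow> \<exists>G\<in>\<G>. F - {w} \<subseteq> G"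
  shows "geometric_realization (facet_complex \<F>) homotopy_equivalent_space geometric_realization (facet_complex \<G>)"
proof -
  have "{\<sigma> \<in> facet_complex \<F>. \<not> \<tau> \<subseteq> \<sigma>} = facet_complex \<G>"
  proof (intro subset_antisym subsetI)
    fix \<sigma> assume \<sigma>: "\<sigma> \<in> {\<sigma> \<in> facet_complex \<F>. \<not> \<tau> \<subseteq> \<sigma>}"
    then have "\<sigma> \<in> facet_complex \<F>"
      by simp
    then obtain F where F: "F \<in> \<F>" "\<sigma> \<subseteq> F" "\<sigma> \<noteq> {}"
      by (rule facet_complexE)
    obtain w where w: "w \<in> \<tau>" "w \<notin> \<sigma>"
      using \<sigma> by blast
    obtain G where "G \<in> \<G>" "F - {w} \<subseteq> G"
    proof (cases "\<tau> \<subseteq> F")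
      case True
      then show ?thesis
        using bdry[OF F(1) _ w(1)] that by blast
    next
      case False
      then show ?thesis
        using sup[OF F(1)] that by blast
    qed
    moreover have "\<sigma> \<subseteq> F - {w}"
      using F w by blast
    ultimately show "\<sigma> \<in> facet_complex \<G>"
      using F(3) by (intro facet_complexI[of G]) simp_all
  next
    fix \<sigma> assume "\<sigma> \<in> facet_complex \<G>"
    then obtain G where G: "G \<in> \<G>" "\<sigma> \<subseteq> G" "\<sigma> \<noteq> {}"
      by (elim facet_complexE)
    then obtain F where "\<not> \<tau> \<subseteq> G" "F \<in> \<F>" "G \<subseteq> F"
      using sub by blast
    then show "\<sigma> \<in> {\<sigma> \<in> facet_complex \<F>. \<not> \<tau> \<subseteq> \<sigma>}"
      using G by (auto intro: facet_complexI[of F])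
  qed
  moreover have "geometric_realization (facet_complex \<F>) homotopy_equivalent_space
      geometric_realization {\<sigma> \<in> facet_complex \<F>. \<not> \<tau> \<subseteq> \<sigma>}"
    using downset_facet_complex \<tau>
  proof (rule homotopy_equivalent_space_collapse)
    fix \<sigma> assume "\<sigma> \<in> facet_complex \<F>" and \<tau>\<sigma>: "\<tau> \<subseteq> \<sigma>"
    then obtain F where F: "F \<in> \<F>" "\<sigma> \<subseteq> F"
      by (elim facet_complexE)
    then obtain F' where "F' \<in> \<F>" "insert v F \<subseteq> F'"
      using apex[of F] \<tau>\<sigma> by auto
    then show "insert v \<sigma> \<in> facet_complex \<F>"
      using F(2) by (intro facet_complexI[of F']) auto
  qed
  ultimately show ?thesis
    by simp
qed

text \<open>The parameter \<open>w\<close> counts steps, so an arc has \<open>w + 1\<close> indices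
  and the arcs of four are \<open>arcs \<phi> 3\<close>. Indices range over all integers; the
  wrapping around is left to the periodicity of \<open>\<phi>\<close>.\<close>

definition arcs :: "(int \<Rightarrow> 'a) \<Rightarrow> nat \<Rightarrow> 'a set set" where
  "arcs \<phi> w = range (\<lambda>j. \<phi> ` {j..j + int w})"

lemma dvd_bounded_eq_0:
  fixes m k :: int
  assumes "m dvd k" "\<bar>k\<bar> < m"
  shows "k = 0"
  using assms by (meson dvd_imp_le_int not_le abs_ge_self order_less_le_trans)

lemma range_periodic:
  fixes \<phi> :: "int \<Rightarrow> 'a"
  assumes "m > 0" and \<phi>: "\<And>i j. \<phi> i = \<phi> j \<longleftrightarrow> int m dvd i - j"
  shows "range \<phi> = \<phi> ` {0..<int m}"
proof -
  have "\<phi> i = \<phi> (i mod int m)" for i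
    unfolding \<phi> by (simp add: mod_eq_dvd_iff[symmetric])
  moreover have "i mod int m \<in> {0..<int m}" for i
    using assms(1) by simp
  ultimately show ?thesis
    by blast
qed

text \<open>The collapsing faces are the end pairs \<open>?\<tau> i\<close>. As
  \<open>2 * Suc w < m\<close>, each lies in only one arc (\<open>key\<close>), whose second element
  serves as apex, and no simplex contains two of them. A simplex without the end pair of its arc
  misses the first or the last element, so it fits into an arc with one step fewer.\<close>

lemma homotopy_equivalent_space_arcs:
  fixes \<phi> :: "int \<Rightarrow> 'a"
  assumes w: "w \<ge> 1" "2 * Suc w < m" and \<phi>: "\<And>i j. \<phi> i = \<phi> j \<longleftrightarrow> int m dvd i - j"
  shows "geometric_realization (facet_complex (arcs \<phi> (Suc w))) homotopy_equivalent_space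
    geometric_realization (facet_complex (arcs \<phi> w))"
proof -
  let ?F = "\<lambda>j. \<phi> ` {j..j + int (Suc w)}"
  let ?\<tau> = "\<lambda>i. {\<phi> i, \<phi> (i + int (Suc w))}"
  have key: "int m dvd i - j" if sub: "?\<tau> i \<subseteq> ?F j" for i j
  proof -
    obtain a where a: "\<phi> i = \<phi> (j + a)" "0 \<le> a" "a \<le> int (Suc w)"
    proof -
      obtain x where "\<phi> i = \<phi> x" "x \<in> {j..j + int (Suc w)}"
        using sub by blast
      then show ?thesis
        using that[of "x - j"] by auto
    qed
    obtain b where b: "\<phi> (i + int (Suc w)) = \<phi> (j + b)" "0 \<le> b" "b \<le> int (Suc w)"
    proof -
      obtain x where "\<phi> (i + int (Suc w)) = \<phi> x" "x \<in> {j..j + int (Suc w)}"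
        using sub by blast
      then show ?thesis
        using that[of "x - j"] by auto
    qed
    have 1: "int m dvd i - (j + a)" and 2: "int m dvd i + int (Suc w) - (j + b)"
      using a b \<phi> by blast+
    \<comment> \<open>The number \<open>int (Suc w) - b + a\<close> is a sum of two nonnegative
      terms, each at most \<open>Suc w\<close>. Being a multiple of \<open>m\<close> and less than
      \<open>m\<close>, it is 0, and so is \<open>a\<close>.\<close>
    have "int m dvd int (Suc w) - b + a"
      using dvd_diff[OF 2 1] by (simp add: algebra_simps)
    then have "int (Suc w) - b + a = 0"
      using a b w by (intro dvd_bounded_eq_0) auto
    then have "a = 0"
      using a b by simp
    then show ?thesis
      using 1 by simp
  qed
  have shift: "\<phi> (i + a) = \<phi> (j + a)" if "int m dvd i - j" for i j a
    using that by (simp add: \<phi>)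
  have "finite (range \<phi>)"
    using range_periodic[OF _ \<phi>] w by simp
  moreover have "range ?\<tau> \<subseteq> Pow (range \<phi>)"
    by auto
  ultimately have fin: "finite (range ?\<tau>)"
    by (metis finite_Pow_iff finite_subset)
  have "geometric_realization (facet_complex (arcs \<phi> (Suc w))) homotopy_equivalent_space
    geometric_realization {\<sigma> \<in> facet_complex (arcs \<phi> (Suc w)). \<forall>\<tau>\<in>range ?\<tau>. \<not> \<tau> \<subseteq> \<sigma>}"
  proof (rule homotopy_equivalent_space_collapse_many[OF downset_facet_complex fin])
    fix \<tau> assume "\<tau> \<in> range ?\<tau>"
    then obtain i where i: "\<tau> = ?\<tau> i"
      by blast
    have "\<not> int m dvd (i + 1) - i" "\<not> int m dvd (i + 1) - (i + int (Suc w))"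
      using dvd_bounded_eq_0[of "int m" "(i + 1) - i"]
        dvd_bounded_eq_0[of "int m" "(i + 1) - (i + int (Suc w))"] w by auto
    then have "\<phi> (i + 1) \<notin> \<tau>"
      unfolding i using \<phi> by blast
    moreover have "insert (\<phi> (i + 1)) \<sigma> \<in> facet_complex (arcs \<phi> (Suc w))"
      if \<sigma>: "\<sigma> \<in> facet_complex (arcs \<phi> (Suc w))" "\<tau> \<subseteq> \<sigma>" for \<sigma>
    proof -
      obtain j where j: "\<sigma> \<subseteq> ?F j"
        using \<sigma> by (auto simp: facet_complex_def arcs_def)
      then have "\<phi> (i + 1) = \<phi> (j + 1)"
        using \<sigma> key shift unfolding i by (meson order_trans)
      then have "insert (\<phi> (i + 1)) \<sigma> \<subseteq> ?F j"
        using j w by auto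
      then show ?thesis
        unfolding facet_complex_def arcs_def by blast
    qed
    ultimately show "finite \<tau> \<and> \<tau> \<noteq> {} \<and> (\<exists>v. v \<notin> \<tau> \<and>
        (\<forall>\<sigma>\<in>facet_complex (arcs \<phi> (Suc w)). \<tau> \<subseteq> \<sigma> \<longrightarrow> insert v \<sigma> \<in> facet_complex (arcs \<phi> (Suc w))))"
      unfolding i by blast
  next
    fix \<tau> \<tau>' \<sigma>
    assume "\<tau> \<in> range ?\<tau>" "\<tau>' \<in> range ?\<tau>" and \<sigma>: "\<sigma> \<in> facet_complex (arcs \<phi> (Suc w))" "\<tau> \<subseteq> \<sigma>" "\<tau>' \<subseteq> \<sigma>"
    then obtain i i' where i: "\<tau> = ?\<tau> i" "\<tau>' = ?\<tau> i'"
      by blast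
    obtain j where "\<sigma> \<subseteq> ?F j"
      using \<sigma> by (auto simp: facet_complex_def arcs_def)
    then have "int m dvd i - j" "int m dvd i' - j"
      using \<sigma>(2,3) key unfolding i by (meson order_trans)+
    then show "\<tau> = \<tau>'"
      unfolding i using shift[of i j 0] shift[of i' j 0] shift[of i j "int (Suc w)"]
        shift[of i' j "int (Suc w)"] by simp
  qed
  moreover have "{\<sigma> \<in> facet_complex (arcs \<phi> (Suc w)). \<forall>\<tau>\<in>range ?\<tau>. \<not> \<tau> \<subseteq> \<sigma>} = facet_complex (arcs \<phi> w)"
  proof (intro subset_antisym subsetI)
    fix \<sigma> assume \<sigma>: "\<sigma> \<in> {\<sigma> \<in> facet_complex (arcs \<phi> (Suc w)). \<forall>\<tau>\<in>range ?\<tau>. \<not> \<tau> \<subseteq> \<sigma>}"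
    then obtain j where j: "\<sigma> \<noteq> {}" "\<sigma> \<subseteq> ?F j"
      by (auto simp: facet_complex_def arcs_def)
    have "\<not> ?\<tau> j \<subseteq> \<sigma>"
      using \<sigma> by blast
    then consider "\<phi> j \<notin> \<sigma>" | "\<phi> (j + int (Suc w)) \<notin> \<sigma>"
      by blast
    then show "\<sigma> \<in> facet_complex (arcs \<phi> w)"
    proof cases
      case 1
      have "{j..j + int (Suc w)} = insert j {j + 1..j + 1 + int w}"
        by auto
      then have "\<sigma> \<subseteq> \<phi> ` {j + 1..j + 1 + int w}"
        using 1 j by auto
      then show ?thesis
        using j(1) by (auto simp: facet_complex_def arcs_def)
    next
      case 2
      have "{j..j + int (Suc w)} = insert (j + int (Suc w)) {j..j + int w}"
        by auto
      then have "\<sigma> \<subseteq> \<phi> ` {j..j + int w}"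
        using 2 j by auto
      then show ?thesis
        using j(1) by (auto simp: facet_complex_def arcs_def)
    qed
  next
    fix \<sigma> assume "\<sigma> \<in> facet_complex (arcs \<phi> w)"
    then obtain j where j: "\<sigma> \<noteq> {}" "\<sigma> \<subseteq> \<phi> ` {j..j + int w}"
      by (auto simp: facet_complex_def arcs_def)
    have sub: "\<phi> ` {j..j + int w} \<subseteq> ?F j"
      by (intro image_mono) auto
    \<comment> \<open>By \<open>key\<close> such an end pair would be that of the arc at
      \<open>j\<close>, whose last element lies outside the shortened arc.\<close>
    have "\<not> ?\<tau> i \<subseteq> \<sigma>" for i
    proof
      assume i: "?\<tau> i \<subseteq> \<sigma>"
      then have "?\<tau> i \<subseteq> ?F j"
        using j(2) sub by (meson order_trans)
      then have "\<phi> (i + int (Suc w)) = \<phi> (j + int (Suc w))"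
        using key shift by blast
      then have "\<phi> (j + int (Suc w)) \<in> \<phi> ` {j..j + int w}"
        using i j by auto
      then obtain c where c: "\<phi> (j + int (Suc w)) = \<phi> c" "j \<le> c" "c \<le> j + int w"
        by auto
      then have "j + int (Suc w) - c = 0"
        using w \<phi>[of "j + int (Suc w)" c] by (intro dvd_bounded_eq_0[of "int m"]) auto
      then show False
        using c by simp
    qed
    moreover have "\<sigma> \<subseteq> ?F j"
      using j(2) sub by (rule subset_trans)
    then have "\<sigma> \<in> facet_complex (arcs \<phi> (Suc w))"
      using j(1) by (auto simp only: facet_complex_def arcs_def)
    ultimately show "\<sigma> \<in> {\<sigma> \<in> facet_complex (arcs \<phi> (Suc w)). \<forall>\<tau>\<in>range ?\<tau>. \<not> \<tau> \<subseteq> \<sigma>}"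
      by auto
  qed
  ultimately show ?thesis
    by simp
qed

section \<open>Simplex boundaries, cycles, and the periods from 7 on\<close>

lemma simplex_boundary_eq_facet_complex: "{\<sigma>. \<sigma> \<noteq> {} \<and> \<sigma> \<subset> U} = facet_complex ((\<lambda>u. U - {u}) ` U)"
  unfolding facet_complex_def by blast

text \<open>The cycle has the \<open>k + 1\<close> vertices \<open>\<psi> 0\<close>, ...,
  \<open>\<psi> k\<close>. Its closing edge stands apart because it is the only edge replaced when
  \<open>k\<close> grows.\<close>

definition cycle_edges :: "(nat \<Rightarrow> 'a) \<Rightarrow> nat \<Rightarrow> 'a set set" where
  "cycle_edges \<psi> k = insert {\<psi> k, \<psi> 0} ((\<lambda>j. {\<psi> j, \<psi> (Suc j)}) ` {..<k})"

text \<open>Both cycles are collapses of the smaller cycle with a triangle attached along its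
  closing edge.\<close>

lemma homotopy_equivalent_space_cycle_Suc:
  assumes k: "k \<ge> 2" and inj: "inj_on \<psi> {..Suc k}"
  shows "geometric_realization (facet_complex (cycle_edges \<psi> (Suc k))) homotopy_equivalent_space
    geometric_realization (facet_complex (cycle_edges \<psi> k))"
proof -
  have \<psi>: "\<psi> i = \<psi> j \<longleftrightarrow> i = j" if "i \<le> Suc k" "j \<le> Suc k" for i j
    using that inj by (auto dest: inj_onD)
  let ?Q = "insert {\<psi> k, \<psi> (Suc k), \<psi> 0} (cycle_edges \<psi> k)"
  have Suc_eq: "cycle_edges \<psi> (Suc k) =
      {{\<psi> (Suc k), \<psi> 0}, {\<psi> k, \<psi> (Suc k)}} \<union> (\<lambda>j. {\<psi> j, \<psi> (Suc j)}) ` {..<k}"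
    unfolding cycle_edges_def lessThan_Suc by auto
  have edge: "\<psi> (Suc k) \<notin> {\<psi> j, \<psi> (Suc j)}" "\<not> {\<psi> k, \<psi> 0} \<subseteq> {\<psi> j, \<psi> (Suc j)}" if "j < k" for j
    using that k by (auto simp: \<psi>)
  have "geometric_realization (facet_complex ?Q) homotopy_equivalent_space
      geometric_realization (facet_complex (cycle_edges \<psi> (Suc k)))"
  proof (rule homotopy_equivalent_space_collapse_facet_complex[of "{\<psi> k, \<psi> 0}" "\<psi> (Suc k)"])
    show "\<exists>F'\<in>?Q. insert (\<psi> (Suc k)) F \<subseteq> F'" if "F \<in> ?Q" "{\<psi> k, \<psi> 0} \<subseteq> F" for F
      using that edge(2) by (auto simp: cycle_edges_def)
    show "\<not> {\<psi> k, \<psi> 0} \<subseteq> G \<and> (\<exists>F\<in>?Q. G \<subseteq> F)" if "G \<in> cycle_edges \<psi> (Suc k)" for G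
      using that k edge(2) unfolding Suc_eq cycle_edges_def by (auto simp: \<psi>)
    show "\<exists>G\<in>cycle_edges \<psi> (Suc k). F \<subseteq> G" if "F \<in> ?Q" "\<not> {\<psi> k, \<psi> 0} \<subseteq> F" for F
      using that unfolding Suc_eq cycle_edges_def by auto
    show "\<exists>G\<in>cycle_edges \<psi> (Suc k). F - {w} \<subseteq> G"
      if "F \<in> ?Q" "{\<psi> k, \<psi> 0} \<subseteq> F" "w \<in> {\<psi> k, \<psi> 0}" for F w
      using that k edge(2) unfolding Suc_eq cycle_edges_def by (auto simp: \<psi>)
  qed (use k in \<open>auto simp: \<psi>\<close>)
  moreover have "geometric_realization (facet_complex ?Q) homotopy_equivalent_space
      geometric_realization (facet_complex (cycle_edges \<psi> k))"
  proof (rule homotopy_equivalent_space_collapse_facet_complex[of "{\<psi> (Suc k)}" "\<psi> 0"])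
    show "\<exists>F'\<in>?Q. insert (\<psi> 0) F \<subseteq> F'" if "F \<in> ?Q" "{\<psi> (Suc k)} \<subseteq> F" for F
      using that edge(1) by (auto simp: cycle_edges_def \<psi>)
    show "\<not> {\<psi> (Suc k)} \<subseteq> G \<and> (\<exists>F\<in>?Q. G \<subseteq> F)" if "G \<in> cycle_edges \<psi> k" for G
      using that edge(1) unfolding cycle_edges_def by (auto simp: \<psi>)
    show "\<exists>G\<in>cycle_edges \<psi> k. F \<subseteq> G" if "F \<in> ?Q" "\<not> {\<psi> (Suc k)} \<subseteq> F" for F
      using that by auto
    show "\<exists>G\<in>cycle_edges \<psi> k. F - {w} \<subseteq> G"
      if "F \<in> ?Q" "{\<psi> (Suc k)} \<subseteq> F" "w \<in> {\<psi> (Suc k)}" for F w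
      using that edge(1) unfolding cycle_edges_def by (auto simp: \<psi>)
  qed (use k in \<open>auto simp: \<psi>\<close>)
  ultimately show ?thesis
    by (meson homotopy_eqv_trans homotopy_equivalent_space_sym)
qed

text \<open>The induction starts with the triangle, the boundary of a 2-simplex. In
  \<open>wedge_of_spheres 1 1\<close> the dimension comes first and the number of summands second,
  so this is one circle.\<close>

lemma wedge_of_spheres_cycle:
  assumes "k \<ge> 2" "inj_on \<psi> {..k}"
  shows "geometric_realization (facet_complex (cycle_edges \<psi> k)) homotopy_equivalent_space wedge_of_spheres 1 1"
  using assms
proof (induction k rule: dec_induct)
  case base
  let ?U = "{\<psi> 0, \<psi> 1, \<psi> 2}"
  let ?L = "{\<sigma>. \<sigma> \<noteq> {} \<and> \<sigma> \<subset> ?U}"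
  have \<psi>: "\<psi> i = \<psi> j \<longleftrightarrow> i = j" if "i \<le> 2" "j \<le> 2" for i j
    using that inj_on_eq_iff[OF base.prems(1), of i j] by simp
  have card: "card ?U = 1 + 2"
    by (simp add: \<psi>)
  obtain h where h: "homeomorphic_map (nsphere 1) (geometric_realization ?L) h"
    "h nsphere_base = (\<lambda>w. if w = \<psi> 0 then 1 else 0)"
  proof -
    have U: "finite ?U" "\<psi> 0 \<in> ?U"
      by simp_all
    show ?thesis
      by (rule nsphere_homeomorphic_simplex_boundary[OF U(1) card U(2) that])
  qed
  have "geometric_realization (\<Union>i<1::nat. ?L) homeomorphic_space wedge_of_spheres 1 1"
    by (rule wedge_of_spheres_homeomorphic[where h = "\<lambda>_. h" and L = "\<lambda>_. ?L" and v = "\<psi> 0"]) (use h in simp_all)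
  moreover have "(\<Union>i<1::nat. ?L) = facet_complex (cycle_edges \<psi> 2)"
  proof -
    have "?U - {\<psi> 0} = {\<psi> 1, \<psi> 2}" "?U - {\<psi> 1} = {\<psi> 2, \<psi> 0}" "?U - {\<psi> 2} = {\<psi> 0, \<psi> 1}"
      by (auto simp: \<psi>)
    moreover have "{..<2::nat} = {0, 1}" "Suc 1 = 2"
      by auto
    ultimately have "cycle_edges \<psi> 2 = (\<lambda>u. ?U - {u}) ` ?U"
      unfolding cycle_edges_def by (simp only: image_insert image_empty One_nat_def[symmetric]) blast
    moreover have "(\<Union>i<1::nat. ?L) = ?L"
      by auto
    ultimately show ?thesis
      unfolding simplex_boundary_eq_facet_complex by (simp only:)
  qed
  ultimately have "geometric_realization (facet_complex (cycle_edges \<psi> 2)) homeomorphic_space wedge_of_spheres 1 1"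
    by (simp only:)
  then show ?case
    by (rule homeomorphic_imp_homotopy_equivalent_space)
next
  case (step k)
  have "inj_on \<psi> {..k}"
    using step.prems by (rule inj_on_subset) auto
  then show ?case
    using homotopy_eqv_trans[OF homotopy_equivalent_space_cycle_Suc[OF step.hyps(1) step.prems(1)] step.IH]
    by simp
qed

lemma inj_on_periodic:
  fixes \<phi> :: "int \<Rightarrow> 'a"
  assumes "\<And>i j. \<phi> i = \<phi> j \<longleftrightarrow> int m dvd i - j"
  shows "inj_on \<phi> {0..<int m}"
proof (rule inj_onI)
  fix i j assume "i \<in> {0..<int m}" "j \<in> {0..<int m}" "\<phi> i = \<phi> j"
  then have "i - j = 0"
    using assms by (intro dvd_bounded_eq_0[of "int m"]) auto
  then show "i = j"
    by simp
qed

text \<open>An arc starting at an index congruent to \<open>k\<close> modulo \<open>Suc k\<close>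
  wraps around and is the closing edge.\<close>

lemma arcs_1_eq_cycle_edges:
  fixes \<phi> :: "int \<Rightarrow> 'a"
  assumes \<phi>: "\<And>i j. \<phi> i = \<phi> j \<longleftrightarrow> int (Suc k) dvd i - j"
  shows "arcs \<phi> 1 = cycle_edges (\<lambda>i. \<phi> (int i)) k"
proof -
  have "{j..j + int 1} = {j, j + 1}" for j
    by auto
  then have img: "\<phi> ` {j..j + int 1} = {\<phi> j, \<phi> (j + 1)}" for j
    by simp
  have last: "\<phi> (int k + 1) = \<phi> 0"
    unfolding \<phi> by (simp add: add.commute)
  have "{\<phi> j, \<phi> (j + 1)} \<in> cycle_edges (\<lambda>i. \<phi> (int i)) k" for j
  proof -
    define i where "i = nat (j mod int (Suc k))"
    have i: "int i = j mod int (Suc k)"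
      by (simp add: i_def)
    then have "int i < int (Suc k)"
      by simp
    then consider "i = k" | "i < k"
      by linarith
    moreover have "int (Suc k) dvd int i - j"
      unfolding i mod_eq_dvd_iff[symmetric] by simp
    then have "\<phi> j = \<phi> (int i)" "\<phi> (j + 1) = \<phi> (int i + 1)"
      unfolding \<phi> by (simp_all add: dvd_diff_commute)
    ultimately show ?thesis
      using last by cases (auto simp: cycle_edges_def add.commute)
  qed
  moreover have "E \<in> range (\<lambda>j. {\<phi> j, \<phi> (j + 1)})" if E: "E \<in> cycle_edges (\<lambda>i. \<phi> (int i)) k" for E
  proof -
    consider "E = {\<phi> (int k), \<phi> (int k + 1)}" | j where "E = {\<phi> (int j), \<phi> (int j + 1)}"
      using E unfolding cycle_edges_def last by (auto simp: add.commute)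
    then show ?thesis
      by cases blast+
  qed
  ultimately show ?thesis
    unfolding arcs_def img by (intro subset_antisym subsetI) auto
qed

text \<open>Shortening from 3 to 2 steps requires \<open>6 < m\<close>, which is where the bound 7
  comes from; the next shortening requires only \<open>4 < m\<close>.\<close>

lemma wedge_of_spheres_arcs:
  fixes \<phi> :: "int \<Rightarrow> 'a"
  assumes m: "m \<ge> 7" and \<phi>: "\<And>i j. \<phi> i = \<phi> j \<longleftrightarrow> int m dvd i - j"
  shows "geometric_realization (facet_complex (arcs \<phi> 3)) homotopy_equivalent_space wedge_of_spheres 1 1"
proof -
  define k where "k = m - 1"
  have k: "m = Suc k"
    using m by (simp add: k_def)
  have "inj_on (\<phi> \<circ> int) {..k}"
    using k by (intro comp_inj_on inj_on_subset[OF inj_on_periodic[OF \<phi>]]) auto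
  then have cycle: "geometric_realization (facet_complex (arcs \<phi> 1)) homotopy_equivalent_space wedge_of_spheres 1 1"
    unfolding arcs_1_eq_cycle_edges[OF \<phi>[unfolded k]] using m k
    by (intro wedge_of_spheres_cycle) (simp_all add: o_def)
  have "geometric_realization (facet_complex (arcs \<phi> (Suc 2))) homotopy_equivalent_space
      geometric_realization (facet_complex (arcs \<phi> 2))"
    by (rule homotopy_equivalent_space_arcs[OF _ _ \<phi>]) (use m in simp_all)
  moreover have "geometric_realization (facet_complex (arcs \<phi> (Suc 1))) homotopy_equivalent_space
      geometric_realization (facet_complex (arcs \<phi> 1))"
    by (rule homotopy_equivalent_space_arcs[OF _ _ \<phi>]) (use m in simp_all)
  moreover have "Suc 2 = 3" "Suc 1 = 2"
    by simp_all
  ultimately show ?thesis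
    using homotopy_eqv_trans[OF homotopy_eqv_trans cycle] by (simp only:)
qed

section \<open>The periods 5 and 6\<close>

lemma arcs_3_eq_simplex_boundary:
  fixes \<phi> :: "int \<Rightarrow> 'a"
  assumes \<phi>: "\<And>i j. \<phi> i = \<phi> j \<longleftrightarrow> int 5 dvd i - j"
  shows "facet_complex (arcs \<phi> 3) = {\<sigma>. \<sigma> \<noteq> {} \<and> \<sigma> \<subset> range \<phi>}"
proof -
  \<comment> \<open>Modulo 5, four consecutive residues omit exactly the one preceding them.\<close>
  have facet: "\<phi> ` {j..j + int 3} = range \<phi> - {\<phi> (j - 1)}" for j
  proof -
    have "\<phi> (j - 1) \<notin> \<phi> ` {j..j + int 3}"
    proof
      assume "\<phi> (j - 1) \<in> \<phi> ` {j..j + int 3}"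
      then obtain x where x: "int 5 dvd (j - 1) - x" "x \<in> {j..j + int 3}"
        using \<phi> by blast
      then have "(j - 1) - x = 0"
        by (intro dvd_bounded_eq_0[of "int 5"]) auto
      then show False
        using x by simp
    qed
    moreover have "\<phi> x \<in> insert (\<phi> (j - 1)) (\<phi> ` {j..j + int 3})" for x
    proof -
      \<comment> \<open>\<open>y\<close> is the representative of \<open>x\<close> modulo 5 in the
        window from \<open>j - 1\<close> to \<open>j + 3\<close>.\<close>
      define y where "y = j - 1 + (x - (j - 1)) mod 5"
      have "x - y = (x - (j - 1)) - (x - (j - 1)) mod 5"
        by (simp add: y_def)
      then have "\<phi> x = \<phi> y"
        unfolding \<phi> by (simp add: minus_mod_eq_mult_div)
      moreover have "0 \<le> (x - (j - 1)) mod 5" "(x - (j - 1)) mod 5 < 5"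
        by simp_all
      then have "y = j - 1 \<or> y \<in> {j..j + int 3}"
        unfolding y_def by auto
      ultimately show ?thesis
        by auto
    qed
    ultimately show ?thesis
      by blast
  qed
  have "range (\<lambda>j :: int. j - 1) = UNIV"
    by (rule surjI[of _ "\<lambda>j. j + 1"]) simp
  then have "range (\<lambda>j. range \<phi> - {\<phi> (j - 1)}) = range (\<lambda>i. range \<phi> - {\<phi> i})"
    using image_image[of "\<lambda>i. range \<phi> - {\<phi> i}" "\<lambda>j. j - 1" UNIV] by simp
  then show ?thesis
    unfolding arcs_def facet simplex_boundary_eq_facet_complex by (simp add: image_image)
qed

lemma nsphere_arcs:
  fixes \<phi> :: "int \<Rightarrow> 'a"
  assumes \<phi>: "\<And>i j. \<phi> i = \<phi> j \<longleftrightarrow> int 5 dvd i - j"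
  shows "geometric_realization (facet_complex (arcs \<phi> 3)) homotopy_equivalent_space nsphere 3"
proof -
  have range: "range \<phi> = \<phi> ` {0..<int 5}"
    using range_periodic[OF _ \<phi>] by simp
  then have card: "card (range \<phi>) = 3 + 2"
    using card_image[OF inj_on_periodic[OF \<phi>]] by simp
  have fin: "finite (range \<phi>)"
    unfolding range by simp
  obtain h where
    "homeomorphic_map (nsphere 3) (geometric_realization (facet_complex (arcs \<phi> 3))) h"
    unfolding arcs_3_eq_simplex_boundary[OF \<phi>]
    by (rule nsphere_homeomorphic_simplex_boundary[OF fin card rangeI])
  then have "nsphere 3 homeomorphic_space geometric_realization (facet_complex (arcs \<phi> 3))"
    by (rule homeomorphic_map_imp_homeomorphic_space)
  then have "geometric_realization (facet_complex (arcs \<phi> 3)) homeomorphic_space nsphere 3"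
    by (subst homeomorphic_space_sym)
  then show ?thesis
    by (rule homeomorphic_imp_homotopy_equivalent_space)
qed

text \<open>The collapses up to \<open>?F4\<close> remove the edges \<open>bd\<close>, \<open>ae\<close>, \<open>ab\<close>, \<open>de\<close> and leave the boundaries of
  \<open>bcef\<close> and \<open>acdf\<close>, which share the edge \<open>cf\<close>. In \<open>?Q\<close> the vertex \<open>g\<close> doubles the vertex \<open>f\<close> of \<open>acdf\<close>:
  removing \<open>g\<close> gives \<open>?F4\<close> back, whereas removing \<open>af\<close>, \<open>df\<close> and \<open>fg\<close> leaves the boundaries of
  \<open>bcef\<close> and \<open>acdg\<close>, which share only \<open>c\<close>.\<close>

lemma wedge_of_spheres_hexagon:
  assumes dist: "distinct [a, b, c, d, e, f, g]"
  shows "geometric_realization (facet_complex {{a,b,c,d}, {b,c,d,e}, {c,d,e,f}, {d,e,f,a}, {e,f,a,b}, {f,a,b,c}})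
    homotopy_equivalent_space wedge_of_spheres 2 2"
proof -
  have ne: "a \<noteq> b" "a \<noteq> c" "a \<noteq> d" "a \<noteq> e" "a \<noteq> f" "a \<noteq> g"
    "b \<noteq> c" "b \<noteq> d" "b \<noteq> e" "b \<noteq> f" "b \<noteq> g" "c \<noteq> d" "c \<noteq> e" "c \<noteq> f" "c \<noteq> g"
    "d \<noteq> e" "d \<noteq> f" "d \<noteq> g" "e \<noteq> f" "e \<noteq> g" "f \<noteq> g"
    using dist by simp_all
  note ne = ne ne[symmetric]
  let ?h = "\<lambda>\<F> \<G>. geometric_realization (facet_complex \<F>) homotopy_equivalent_space geometric_realization (facet_complex \<G>)"
  let ?F0 = "{{a,b,c,d}, {b,c,d,e}, {c,d,e,f}, {d,e,f,a}, {e,f,a,b}, {f,a,b,c}}"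
  let ?F1 = "{{a,c,d}, {b,c,e}, {c,d,e,f}, {d,e,f,a}, {e,f,a,b}, {f,a,b,c}}"
  let ?F2 = "{{a,c,d}, {b,c,e}, {a,d,f}, {b,e,f}, {c,d,e,f}, {f,a,b,c}}"
  let ?F3 = "{{a,c,d}, {b,c,e}, {a,d,f}, {b,e,f}, {c,d,e,f}, {a,c,f}, {b,c,f}}"
  let ?F4 = "{{a,c,d}, {b,c,e}, {a,d,f}, {b,e,f}, {a,c,f}, {b,c,f}, {c,d,f}, {c,e,f}}"
  let ?Q = "{{b,c,e}, {b,e,f}, {b,c,f}, {c,e,f}, {a,c,f,g}, {a,d,f,g}, {c,d,f,g}, {a,c,d}}"
  let ?Q1 = "{{b,c,e}, {b,e,f}, {b,c,f}, {c,e,f}, {a,c,g}, {a,d,g}, {c,d,f,g}, {a,c,d}}"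
  let ?Q2 = "{{b,c,e}, {b,e,f}, {b,c,f}, {c,e,f}, {a,c,g}, {a,d,g}, {c,f,g}, {c,d,g}, {a,c,d}}"
  let ?Q3 = "{{b,c,e}, {b,e,f}, {b,c,f}, {c,e,f}, {a,c,g}, {a,d,g}, {c,d,g}, {a,c,d}}"
  have "?h ?F0 ?F1"
    by (rule homotopy_equivalent_space_collapse_facet_complex[of "{b, d}" c]; (elim insertE emptyE)?;
      simp add: insert_Diff_if ne)
  moreover have "?h ?F1 ?F2"
    by (rule homotopy_equivalent_space_collapse_facet_complex[of "{a, e}" f]; (elim insertE emptyE)?;
      simp add: insert_Diff_if ne)
  moreover have "?h ?F2 ?F3"
    by (rule homotopy_equivalent_space_collapse_facet_complex[of "{a, b}" c]; (elim insertE emptyE)?;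
      simp add: insert_Diff_if ne)
  moreover have "?h ?F3 ?F4"
    by (rule homotopy_equivalent_space_collapse_facet_complex[of "{d, e}" c]; (elim insertE emptyE)?;
      simp add: insert_Diff_if ne)
  moreover have "?h ?Q ?F4"
    by (rule homotopy_equivalent_space_collapse_facet_complex[of "{g}" f]; (elim insertE emptyE)?;
      simp add: insert_Diff_if ne)
  moreover have "?h ?Q ?Q1"
    by (rule homotopy_equivalent_space_collapse_facet_complex[of "{f, a}" g]; (elim insertE emptyE)?;
      simp add: insert_Diff_if ne)
  moreover have "?h ?Q1 ?Q2"
    by (rule homotopy_equivalent_space_collapse_facet_complex[of "{f, d}" g]; (elim insertE emptyE)?;
      simp add: insert_Diff_if ne)
  \<comment> \<open>Now \<open>{c,f,g}\<close> is the only facet containing \<open>fg\<close>. Its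
    other two edges survive, \<open>cf\<close> in \<open>{b,c,f}\<close> and \<open>cg\<close> in
    \<open>{a,c,g}\<close>.\<close>
  moreover have "?h ?Q2 ?Q3"
    by (rule homotopy_equivalent_space_collapse_facet_complex[of "{f, g}" c]; (elim insertE emptyE)?;
      simp add: insert_Diff_if ne)
  ultimately have *: "?h ?F0 ?Q3"
    by (meson homotopy_eqv_trans homotopy_equivalent_space_sym)
  let ?U = "{b, c, e, f}" and ?V = "{a, c, d, g}"
  let ?bd = "\<lambda>W. {\<sigma>. \<sigma> \<noteq> {} \<and> \<sigma> \<subset> W}"
  have U: "finite ?U" "card ?U = 2 + 2" "c \<in> ?U" and V: "finite ?V" "card ?V = 2 + 2" "c \<in> ?V"
    by (simp_all add: ne)
  obtain h1 where h1: "homeomorphic_map (nsphere 2) (geometric_realization (?bd ?U)) h1"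
    "h1 nsphere_base = (\<lambda>w. if w = c then 1 else 0)"
    by (rule nsphere_homeomorphic_simplex_boundary[OF U])
  obtain h2 where h2: "homeomorphic_map (nsphere 2) (geometric_realization (?bd ?V)) h2"
    "h2 nsphere_base = (\<lambda>w. if w = c then 1 else 0)"
    by (rule nsphere_homeomorphic_simplex_boundary[OF V])
  define L where "L i = (if i = 0 then ?bd ?U else ?bd ?V)" for i :: nat
  have disj: "\<sigma> = {c}" if "\<sigma> \<noteq> {}" "\<sigma> \<subset> ?U" "\<sigma> \<subset> ?V" for \<sigma>
  proof -
    have "\<sigma> \<subseteq> ?U \<inter> ?V"
      using that by blast
    also have "?U \<inter> ?V = {c}"
      by (simp add: ne)
    finally show ?thesis
      using that(1) by blast
  qed
  have "geometric_realization (\<Union>i<2. L i) homeomorphic_space wedge_of_spheres 2 2"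
  proof (rule wedge_of_spheres_homeomorphic)
    show "homeomorphic_map (nsphere 2) (geometric_realization (L i)) (if i = 0 then h1 else h2)"
      and "(if i = 0 then h1 else h2) nsphere_base = (\<lambda>w. if w = c then 1 else 0)" for i
      using h1 h2 by (simp_all add: L_def)
    fix i j :: nat assume "i < 2" "j < 2" "i \<noteq> j"
    then have "L i \<inter> L j = ?bd ?U \<inter> ?bd ?V"
      by (cases "i = 0") (simp_all add: L_def Int_commute)
    also have "\<dots> \<subseteq> {{c}}"
      using disj by blast
    finally show "L i \<inter> L j \<subseteq> {{c}}" .
  qed
  moreover have "(\<Union>i<2. L i) = facet_complex ?Q3"
  proof -
    have "{..<2 :: nat} = {0, 1}"
      by auto
    then have "(\<Union>i<2. L i) = facet_complex ((\<lambda>u. ?U - {u}) ` ?U) \<union> facet_complex ((\<lambda>u. ?V - {u}) ` ?V)"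
      by (simp add: L_def simplex_boundary_eq_facet_complex Un_commute)
    also have "\<dots> = facet_complex ((\<lambda>u. ?U - {u}) ` ?U \<union> (\<lambda>u. ?V - {u}) ` ?V)"
      by (auto simp: facet_complex_def)
    also have "(\<lambda>u. ?U - {u}) ` ?U \<union> (\<lambda>u. ?V - {u}) ` ?V = ?Q3"
      by (simp add: insert_Diff_if ne) (simp add: insert_commute)
    finally show ?thesis .
  qed
  ultimately have "geometric_realization (facet_complex ?Q3) homotopy_equivalent_space wedge_of_spheres 2 2"
    by (metis homeomorphic_imp_homotopy_equivalent_space)
  with * show ?thesis
    by (rule homotopy_eqv_trans)
qed

text \<open>The element \<open>g\<close> is the fresh vertex for the expansion; the six values of
  \<open>\<phi>\<close> are the vertices of the hexagon.\<close>

lemma wedge_of_spheres_arcs_6: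
  fixes \<phi> :: "int \<Rightarrow> 'a"
  assumes \<phi>: "\<And>i j. \<phi> i = \<phi> j \<longleftrightarrow> int 6 dvd i - j" and g: "g \<notin> range \<phi>"
  shows "geometric_realization (facet_complex (arcs \<phi> 3)) homotopy_equivalent_space wedge_of_spheres 2 2"
proof -
  have six: "{0..<6 :: int} = {0, 1, 2, 3, 4, 5}"
    by auto
  have img: "\<phi> ` {j..j + int 3} = {\<phi> j, \<phi> (j + 1), \<phi> (j + 2), \<phi> (j + 3)}" for j
  proof -
    have "{j..j + int 3} = {j, j + 1, j + 2, j + 3}"
      by auto
    then show ?thesis
      by simp
  qed
  have "range (\<lambda>j. \<phi> ` {j..j + int 3}) = (\<lambda>j. \<phi> ` {j..j + int 3}) ` {0..<6}"
  proof -
    have "\<phi> ` {j..j + int 3} \<in> (\<lambda>j. \<phi> ` {j..j + int 3}) ` {0..<6}" for j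
    proof (rule image_eqI)
      have "\<phi> (j + a) = \<phi> (j mod 6 + a)" for a
        unfolding \<phi> by (simp add: mod_eq_dvd_iff[symmetric])
      from this[of 0] this[of 1] this[of 2] this[of 3]
      show "\<phi> ` {j..j + int 3} = \<phi> ` {j mod 6..j mod 6 + int 3}"
        unfolding img by simp
    qed simp
    then show ?thesis
      by blast
  qed
  moreover have "\<phi> 6 = \<phi> 0" "\<phi> 7 = \<phi> 1" "\<phi> 8 = \<phi> 2"
    unfolding \<phi> by simp_all
  ultimately have "arcs \<phi> 3 = {{\<phi> 0, \<phi> 1, \<phi> 2, \<phi> 3}, {\<phi> 1, \<phi> 2, \<phi> 3, \<phi> 4}, {\<phi> 2, \<phi> 3, \<phi> 4, \<phi> 5},
      {\<phi> 3, \<phi> 4, \<phi> 5, \<phi> 0}, {\<phi> 4, \<phi> 5, \<phi> 0, \<phi> 1}, {\<phi> 5, \<phi> 0, \<phi> 1, \<phi> 2}}"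
    unfolding arcs_def img six by simp
  moreover have "distinct [\<phi> 0, \<phi> 1, \<phi> 2, \<phi> 3, \<phi> 4, \<phi> 5, g]"
    using g by (auto simp: \<phi>)
  ultimately show ?thesis
    using wedge_of_spheres_hexagon by metis
qed

section \<open>Components of the neighborhood complex\<close>

definition vertex_point :: "'a \<Rightarrow> 'a \<Rightarrow> real" where
  "vertex_point v = (\<lambda>w. if w = v then 1 else 0)"

lemma support_vertex_point: "{w. vertex_point v w \<noteq> 0} = {v}"
  by (auto simp: vertex_point_def)

lemma vertex_point_in_bary_points: "vertex_point v \<in> bary_points K \<longleftrightarrow> {v} \<in> K"
  unfolding bary_points_def mem_Collect_eq support_vertex_point by (simp add: vertex_point_def)

text \<open>The segment from \<open>x\<close> to \<open>y\<close> stays in the realization, because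
  the support of each of its points is contained in the union of the two supports.\<close>

lemma connected_component_bary_points:
  fixes K :: "'a set set"
  assumes K: "downset K" and x: "x \<in> bary_points K" and y: "y \<in> bary_points K"
    and xy: "{v. x v \<noteq> 0} \<union> {v. y v \<noteq> 0} \<in> K"
  shows "connected_component (bary_points K) x y"
proof -
  define p where "p t = (\<lambda>v. (1 - t) * x v + t * y v)" for t :: real
  let ?U = "{v. x v \<noteq> 0} \<union> {v. y v \<noteq> 0}"
  have U: "finite ?U"
    using bary_pointsD(3)[OF x] bary_pointsD(3)[OF y] by simp
  have "p t \<in> bary_points K" if t: "0 \<le> t" "t \<le> 1" for t
  proof (rule bary_pointsI[OF U])
    show "p t v = 0" if "v \<notin> ?U" for v
      using that by (simp add: p_def)
    show "0 \<le> p t v" for v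
      using t bary_pointsD(1)[OF x] bary_pointsD(1)[OF y] by (simp add: p_def)
    have "sum x ?U = 1" "sum y ?U = 1"
      by (rule sum_bary_points[OF x U] sum_bary_points[OF y U]; simp)+
    then show 1: "sum (p t) ?U = 1"
      by (simp add: p_def sum.distrib flip: sum_distrib_left)
    have "{v. p t v \<noteq> 0} \<noteq> {}"
    proof
      assume "{v. p t v \<noteq> 0} = {}"
      then have "sum (p t) ?U = 0"
        by (intro sum.neutral) auto
      with 1 show False by simp
    qed
    moreover have "{v. p t v \<noteq> 0} \<subseteq> ?U"
      by (auto simp: p_def)
    ultimately show "{v. p t v \<noteq> 0} \<in> K"
      using downsetD[OF K xy] by blast
  qed
  then have "p ` {0..1} \<subseteq> bary_points K"
    by auto
  moreover have "continuous_on {0..1} p"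
    unfolding p_def by (intro continuous_on_coordinatewise_then_product continuous_intros)
  then have "connected (p ` {0..1})"
    by (rule connected_continuous_image) simp
  moreover have "x \<in> p ` {0..1}" "y \<in> p ` {0..1}"
    by (auto simp: p_def intro: image_eqI[of _ _ 0] image_eqI[of _ _ 1])
  ultimately show ?thesis
    unfolding connected_component_def by blast
qed

text \<open>Edges join consecutive vertices, hence all vertices by induction in both directions, and
  every point is joined to a vertex of its own support.\<close>

lemma connected_bary_points:
  fixes \<phi> :: "int \<Rightarrow> 'a"
  assumes K: "downset K" and edges: "\<And>i. {\<phi> i, \<phi> (i + 1)} \<in> K"
    and vertices: "\<And>\<sigma>. \<sigma> \<in> K \<Longrightarrow> \<sigma> \<subseteq> range \<phi>"
  shows "connected (bary_points K)"
proof -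
  let ?S = "bary_points K"
  have vertex: "{\<phi> i} \<in> K" for i
    using downsetD[OF K edges[of i], of "{\<phi> i}"] by simp
  have step: "connected_component ?S (vertex_point (\<phi> i)) (vertex_point (\<phi> (i + 1)))" for i
    using edges[of i] vertex
    by (intro connected_component_bary_points[OF K])
      (simp_all add: vertex_point_in_bary_points support_vertex_point insert_commute)
  have path: "connected_component ?S (vertex_point (\<phi> 0)) (vertex_point (\<phi> i))" for i
  proof (induction i rule: int_induct[where k = 0])
    case base
    show ?case
      using vertex by (simp add: vertex_point_in_bary_points)
  next
    case (step1 i)
    show ?case
      using step1(2) step by (rule connected_component_trans)
  next
    case (step2 i)
    show ?case
      using step2(2) step[of "i - 1"] by (metis connected_component_sym connected_component_trans diff_add_cancel)
  qed
  have "connected_component ?S (vertex_point (\<phi> 0)) x" if x: "x \<in> ?S" for x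
  proof -
    obtain v where v: "x v \<noteq> 0"
      using bary_pointsD(4)[OF x] by blast
    then obtain i where i: "v = \<phi> i"
      using vertices[OF bary_pointsD(2)[OF x]] by blast
    have "connected_component ?S (vertex_point v) x"
    proof (rule connected_component_bary_points[OF K _ x])
      show "vertex_point v \<in> ?S"
        using vertex i by (simp add: vertex_point_in_bary_points)
      show "{w. vertex_point v w \<noteq> 0} \<union> {w. x w \<noteq> 0} \<in> K"
        using v bary_pointsD(2)[OF x] by (simp add: support_vertex_point insert_absorb)
    qed
    then show ?thesis
      using path[of i] i connected_component_trans by metis
  qed
  then show ?thesis
    unfolding connected_iff_connected_component
    by (meson connected_component_sym connected_component_trans)
qed

text \<open>No simplex crosses between \<open>V\<close> and its complement, so the points supported
  in \<open>V\<close> form a clopen set. It is connected and meets the component \<open>C\<close>,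
  hence equals \<open>C\<close>.\<close>

lemma subtopology_component_geometric_realization:
  fixes K :: "'a set set"
  assumes sep: "\<And>\<sigma>. \<sigma> \<in> K \<Longrightarrow> \<sigma> \<subseteq> V \<or> \<sigma> \<inter> V = {}"
    and conn: "connected (bary_points {\<sigma> \<in> K. \<sigma> \<subseteq> V})"
    and C: "C \<in> connected_components_of (geometric_realization K)"
    and x: "x \<in> C" "x v \<noteq> 0" "v \<in> V"
  shows "subtopology (geometric_realization K) C = geometric_realization {\<sigma> \<in> K. \<sigma> \<subseteq> V}"
proof -
  let ?N = "geometric_realization K"
  let ?A = "bary_points {\<sigma> \<in> K. \<sigma> \<subseteq> V}"
  let ?B = "bary_points {\<sigma> \<in> K. \<sigma> \<inter> V = {}}"
  have CN: "C \<subseteq> bary_points K"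
    using connected_components_of_subset[OF C] by (simp add: geometric_realization_eq)
  have vanish: "closed {x :: 'a \<Rightarrow> real. \<forall>w\<in>W. x w = 0}" for W
    unfolding Ball_def by (intro closed_Collect_all closed_Collect_imp closed_Collect_eq) (auto intro: continuous_intros)
  have "?A \<union> ?B = bary_points K"
    unfolding bary_points_def using sep by blast
  moreover have "?A \<inter> ?B = {}"
  proof -
    have False if "x \<in> ?A" "x \<in> ?B" for x
      using bary_pointsD(2)[OF that(1)] bary_pointsD(2)[OF that(2)] bary_pointsD(4)[OF that(1)] by blast
    then show ?thesis
      by blast
  qed
  ultimately have AB: "?A \<union> ?B = bary_points K" "?A \<inter> ?B = {}"
    by blast+
  \<comment> \<open>Both parts are cut out by the vanishing of coordinates, hence closed; being
    complementary, they are also open.\<close>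
  have "?A = bary_points K \<inter> {x. \<forall>w\<in>-V. x w = 0}" "?B = bary_points K \<inter> {x. \<forall>w\<in>V. x w = 0}"
    by (auto simp: bary_points_def)
  then have closed: "closedin ?N ?A" "closedin ?N ?B"
    unfolding geometric_realization_eq using vanish by (auto intro: closedin_closed_Int)
  have "?A = topspace ?N - ?B"
    using AB by (auto simp: geometric_realization_eq)
  then have open': "openin ?N ?A"
    using openin_diff[OF openin_topspace closed(2)] by simp
  have "x \<in> ?A"
    using x CN sep[of "{w. x w \<noteq> 0}"] by (auto simp: bary_points_def)
  then have nd: "\<not> disjnt C ?A"
    using x(1) by (auto simp: disjnt_def)
  have "connectedin ?N ?A"
    unfolding geometric_realization_eq connectedin_subtopology using conn AB by auto
  then have "?A \<subseteq> C"
    using connected_components_of_maximal[OF C] nd by blast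
  moreover have "C \<subseteq> ?A"
    using connectedin_clopen_cases[OF connectedin_connected_components_of[OF C] closed(1) open'] nd
    by blast
  ultimately have "C = ?A"
    by blast
  moreover have "bary_points K \<inter> ?A = ?A"
    using AB by blast
  ultimately show ?thesis
    by (simp add: geometric_realization_eq subtopology_subtopology)
qed

text \<open>The differences \<open>3s, s, -s, -3s\<close> are written as \<open>(2e - 3)s\<close>, so that \<open>e\<close> is the position of \<open>x\<close> in
  the arc of neighbors of \<open>y\<close>.\<close>

lemma circulant_adj_iff:
  assumes s: "s \<ge> 1" "6 * s < n"
  shows "circulant_adj n s (3 * s) x y \<longleftrightarrow> x \<in> {1..n} \<and> y \<in> {1..n} \<and>
    (\<exists>e\<in>{0,1,2,3}. int n dvd int x - int y + (3 - 2 * e) * int s)"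
proof -
  have eq: "a mod int n = c \<longleftrightarrow> int n dvd a - c" if "0 \<le> c" "c < int n" for a c
    using that by (simp flip: mod_eq_dvd_iff)
  have minus: "int n dvd a - (int n - c) \<longleftrightarrow> int n dvd a + c" for a c
    using dvd_add_left_iff[of "int n" "- int n" "a + c"] by (simp add: algebra_simps)
  show ?thesis
    unfolding circulant_adj_def circulant_verts_def
    using s by (auto simp: eq minus)
qed

section \<open>Progressions with difference \<open>2 * s\<close> modulo \<open>n\<close>\<close>

definition rotation :: "nat \<Rightarrow> nat \<Rightarrow> nat \<Rightarrow> int \<Rightarrow> nat" where
  "rotation n s p i = nat ((int p + 2 * int s * i - 1) mod int n) + 1"

text \<open>Vertices are numbered from 1, so \<open>rotation\<close> shifts by 1 before and after
  \<open>mod\<close>. This characterization by divisibility hides the shifts.\<close>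

lemma rotation_eq_iff:
  assumes "n > 0"
  shows "rotation n s p i = u \<longleftrightarrow> u \<in> {1..n} \<and> int n dvd int u - (int p + 2 * int s * i)"
proof -
  let ?a = "int p + 2 * int s * i"
  have "rotation n s p i = u \<longleftrightarrow> u \<ge> 1 \<and> int u - 1 = (?a - 1) mod int n"
    using assms by (auto simp: rotation_def)
  also have "\<dots> \<longleftrightarrow> u \<in> {1..n} \<and> (int u - 1) mod int n = (?a - 1) mod int n"
  proof (intro iffI conjI)
    assume L: "u \<ge> 1 \<and> int u - 1 = (?a - 1) mod int n"
    then have "int u - 1 < int n"
      using assms by simp
    then show "u \<in> {1..n}"
      using L by auto
    show "(int u - 1) mod int n = (?a - 1) mod int n"
      using L by simp
  next
    assume R: "u \<in> {1..n} \<and> (int u - 1) mod int n = (?a - 1) mod int n"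
    then have "(int u - 1) mod int n = int u - 1"
      by (intro mod_pos_pos_trivial) auto
    then show "int u - 1 = (?a - 1) mod int n"
      using R by simp
  qed auto
  also have "\<dots> \<longleftrightarrow> u \<in> {1..n} \<and> int n dvd int u - ?a"
    by (simp add: mod_eq_dvd_iff algebra_simps)
  finally show ?thesis .
qed

text \<open>All elements of \<open>\<sigma>\<close> share a neighbor \<open>w\<close>. If
  \<open>rotation n s p i\<close> has position \<open>e\<close> among the neighbors of
  \<open>w\<close>, the one at position \<open>e'\<close> has index \<open>i - e + e'\<close>. One
  vertex in the progression thus forces the whole simplex into the arc starting at
  \<open>i - e\<close>.\<close>

lemma neighborhood_complex_circulant_arc:
  assumes s: "s \<ge> 1" "6 * s < n"
    and \<sigma>: "\<sigma> \<in> neighborhood_complex (circulant_verts n) (circulant_adj n s (3 * s))"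
    and i: "rotation n s p i \<in> \<sigma>"
  shows "\<sigma> \<in> facet_complex (arcs (rotation n s p) 3)"
proof -
  let ?\<phi> = "rotation n s p"
  have n: "n > 0"
    using s by simp
  obtain w where w: "\<And>v. v \<in> \<sigma> \<Longrightarrow> circulant_adj n s (3 * s) v w"
    using \<sigma> by (auto simp: neighborhood_complex_def)
  obtain e where e: "int n dvd int (?\<phi> i) - int w + (3 - 2 * e) * int s"
    using w[OF i] unfolding circulant_adj_iff[OF s] by blast
  have "int n dvd int (?\<phi> i) - (int p + 2 * int s * i)"
    using rotation_eq_iff[OF n, of s p i "?\<phi> i"] by simp
  from dvd_diff[OF e this]
  have w': "int n dvd (int p + 2 * int s * i) - int w + (3 - 2 * e) * int s"
    by (simp add: algebra_simps)
  have "v \<in> ?\<phi> ` {i - e..i - e + int 3}" if v: "v \<in> \<sigma>" for v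
  proof -
    obtain e' where e': "e' \<in> {0, 1, 2, 3}" "v \<in> {1..n}" "int n dvd int v - int w + (3 - 2 * e') * int s"
      using w[OF v] unfolding circulant_adj_iff[OF s] by blast
    from dvd_diff[OF e'(3) w']
    have "int n dvd int v - (int p + 2 * int s * (i - e + e'))"
      by (simp add: algebra_simps)
    then have "?\<phi> (i - e + e') = v"
      using e'(2) rotation_eq_iff[OF n] by blast
    moreover have "i - e + e' \<in> {i - e..i - e + int 3}"
      using e'(1) by auto
    ultimately show ?thesis
      by blast
  qed
  then show ?thesis
    using i unfolding facet_complex_def arcs_def by blast
qed

lemma neighborhood_complex_circulant_eq_arcs:
  assumes s: "s \<ge> 1" "6 * s < n"
  shows "{\<sigma> \<in> neighborhood_complex (circulant_verts n) (circulant_adj n s (3 * s)).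
    \<sigma> \<subseteq> range (rotation n s p)} = facet_complex (arcs (rotation n s p) 3)"
proof (intro subset_antisym subsetI)
  let ?\<phi> = "rotation n s p"
  let ?K = "neighborhood_complex (circulant_verts n) (circulant_adj n s (3 * s))"
  fix \<sigma> assume "\<sigma> \<in> {\<sigma> \<in> ?K. \<sigma> \<subseteq> range ?\<phi>}"
  then have \<sigma>: "\<sigma> \<in> ?K" "\<sigma> \<subseteq> range ?\<phi>" "\<sigma> \<noteq> {}"
    by (auto simp: neighborhood_complex_def)
  then obtain i where "?\<phi> i \<in> \<sigma>"
    by blast
  then show "\<sigma> \<in> facet_complex (arcs ?\<phi> 3)"
    using neighborhood_complex_circulant_arc[OF s \<sigma>(1)] by blast
next
  let ?\<phi> = "rotation n s p"
  let ?K = "neighborhood_complex (circulant_verts n) (circulant_adj n s (3 * s))"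
  fix \<sigma> assume "\<sigma> \<in> facet_complex (arcs ?\<phi> 3)"
  then obtain j where \<sigma>: "\<sigma> \<noteq> {}" "\<sigma> \<subseteq> ?\<phi> ` {j..j + int 3}"
    by (auto simp: facet_complex_def arcs_def)
  have n: "n > 0"
    using s by simp
  \<comment> \<open>The arc of neighbors of \<open>w\<close> starts at \<open>w - 3s\<close>, so the
    common neighbor of the arc at \<open>j\<close> is its first element plus \<open>3s\<close>,
    reduced to a vertex as in \<open>rotation\<close>.\<close>
  define w where "w = nat ((int p + 2 * int s * j + 3 * int s - 1) mod int n) + 1"
  have "(int w - 1) mod int n = (int p + 2 * int s * j + 3 * int s - 1) mod int n"
    using n by (simp add: w_def)
  then have w: "int n dvd int w - (int p + 2 * int s * j + 3 * int s)"
    by (simp add: mod_eq_dvd_iff algebra_simps)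
  have w_in: "w \<in> {1..n}"
    using n by (simp add: w_def nat_less_iff Suc_le_eq)
  have adj: "circulant_adj n s (3 * s) v w" and v_in: "v \<in> {1..n}" if v: "v \<in> \<sigma>" for v
  proof -
    obtain i where i: "i \<in> {j..j + int 3}" "v = ?\<phi> i"
      using v \<sigma>(2) by blast
    then have v': "v \<in> {1..n}" "int n dvd int v - (int p + 2 * int s * i)"
      using rotation_eq_iff[OF n, of s p i v] by auto
    have "i - j \<in> {0, 1, 2, 3}"
      using i(1) by auto
    moreover have "int n dvd int v - int w + (3 - 2 * (i - j)) * int s"
      using dvd_diff[OF v'(2) w] by (simp add: algebra_simps)
    ultimately show "circulant_adj n s (3 * s) v w" "v \<in> {1..n}"
      unfolding circulant_adj_iff[OF s] using v'(1) w_in by blast+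
  qed
  have "finite \<sigma>"
    using v_in by (meson finite_atLeastAtMost finite_subset subsetI)
  then have "\<sigma> \<in> ?K"
    unfolding neighborhood_complex_def circulant_verts_def using \<sigma>(1) adj v_in w_in by blast
  then show "\<sigma> \<in> {\<sigma> \<in> ?K. \<sigma> \<subseteq> range ?\<phi>}"
    using \<sigma>(2) by blast
qed

text \<open>The common factor \<open>g\<close> cancels from \<open>n\<close> and
  \<open>2 * s\<close>, and then the coprime factor \<open>r\<close>; the period \<open>m\<close> is
  the order of \<open>2 * s\<close> modulo \<open>n\<close>.\<close>

lemma rotation_period:
  assumes n: "n > 0" and m: "n = m * g" "2 * s = r * g" "coprime m r"
  shows "rotation n s p i = rotation n s p j \<longleftrightarrow> int m dvd i - j"
proof -
  have g: "g > 0"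
    using n m(1) by (cases "g = 0") auto
  have "rotation n s p i = rotation n s p j \<longleftrightarrow>
      (int p + 2 * int s * i - 1) mod int n = (int p + 2 * int s * j - 1) mod int n"
    using n by (simp add: rotation_def eq_nat_nat_iff)
  also have "\<dots> \<longleftrightarrow> int n dvd 2 * int s * (i - j)"
    by (simp add: mod_eq_dvd_iff algebra_simps)
  also have "2 * int s = int r * int g"
    using m(2) by (metis of_nat_mult of_nat_numeral)
  also have "int n = int m * int g"
    using m(1) by simp
  also have "int m * int g dvd int r * int g * (i - j) \<longleftrightarrow> int m dvd int r * (i - j)"
    using g by (simp add: mult.assoc mult.left_commute[of "int r"] mult.commute[of "int m"])
  also have "\<dots> \<longleftrightarrow> int m dvd i - j"
    using m(3) by (simp add: coprime_dvd_mult_right_iff)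
  finally show ?thesis .
qed

section \<open>Homotopy type of a component\<close>

lemma circulant_component_homotopy_type:
  fixes n s :: nat
  assumes s: "s \<ge> 1" "6 * s < n" "n \<noteq> 8 * s"
  defines "N \<equiv> geometric_realization
    (neighborhood_complex (circulant_verts n) (circulant_adj n s (3 * s)))"
  assumes C: "C \<in> connected_components_of N"
  shows "n = 10 * s \<Longrightarrow> subtopology N C homotopy_equivalent_space nsphere 3"
    and "n = 12 * s \<Longrightarrow> subtopology N C homotopy_equivalent_space wedge_of_spheres 2 2"
    and "n \<notin> {10 * s, 12 * s} \<Longrightarrow> subtopology N C homotopy_equivalent_space wedge_of_spheres 1 1"
proof -
  let ?K = "neighborhood_complex (circulant_verts n) (circulant_adj n s (3 * s))"
  have n: "n > 0"
    using s by simp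
  obtain x where x: "x \<in> C"
    using nonempty_connected_components_of[OF C] by blast
  then have xK: "x \<in> bary_points ?K"
    using connected_components_of_subset[OF C] by (auto simp: N_def geometric_realization_eq)
  obtain p where p: "x p \<noteq> 0"
    using bary_pointsD(4)[OF xK] by blast
  define \<phi> where "\<phi> = rotation n s p"
  have "p \<in> {1..n}"
    using p bary_pointsD(2)[OF xK] by (auto simp: neighborhood_complex_def circulant_verts_def)
  then have \<phi>_0: "\<phi> 0 = p"
    unfolding \<phi>_def by (subst rotation_eq_iff[OF n]) simp
  have arcs: "{\<sigma> \<in> ?K. \<sigma> \<subseteq> range \<phi>} = facet_complex (arcs \<phi> 3)"
    unfolding \<phi>_def by (rule neighborhood_complex_circulant_eq_arcs[OF s(1,2)])
  have component: "subtopology N C = geometric_realization (facet_complex (arcs \<phi> 3))"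
    unfolding N_def arcs[symmetric]
  proof (rule subtopology_component_geometric_realization)
    show "\<sigma> \<subseteq> range \<phi> \<or> \<sigma> \<inter> range \<phi> = {}" if "\<sigma> \<in> ?K" for \<sigma>
      using neighborhood_complex_circulant_arc[OF s(1,2) that] arcs unfolding \<phi>_def by blast
    have "connected (bary_points (facet_complex (arcs \<phi> 3)))"
    proof (rule connected_bary_points[OF downset_facet_complex])
      show "{\<phi> i, \<phi> (i + 1)} \<in> facet_complex (arcs \<phi> 3)" for i
      proof -
        have "{\<phi> i, \<phi> (i + 1)} \<subseteq> \<phi> ` {i..i + int 3}"
          by auto
        then show ?thesis
          unfolding facet_complex_def arcs_def by blast
      qed
      show "\<sigma> \<subseteq> range \<phi>" if "\<sigma> \<in> facet_complex (arcs \<phi> 3)" for \<sigma>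
        using that by (auto simp: facet_complex_def arcs_def)
    qed
    then show "connected (bary_points {\<sigma> \<in> ?K. \<sigma> \<subseteq> range \<phi>})"
      unfolding arcs .
    show "C \<in> connected_components_of (geometric_realization ?K)"
      using C by (simp add: N_def)
    show "p \<in> range \<phi>"
      using \<phi>_0 by blast
  qed (fact x p)+
  define g where "g = gcd n (2 * s)"
  obtain m r where mr: "n = m * g" "2 * s = r * g" "coprime m r"
    using gcd_coprime_exists[of n "2 * s"] n unfolding g_def by auto
  have \<phi>: "\<phi> i = \<phi> j \<longleftrightarrow> int m dvd i - j" for i j
    unfolding \<phi>_def by (rule rotation_period[OF n mr])
  have g: "g > 0" and r: "r > 0"
    using s n mr by (auto intro: Nat.gr0I)
  have "3 * r * g < m * g"
    using s(2) mr by linarith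
  then have m: "3 * r < m"
    using g by simp
  \<comment> \<open>The equation \<open>n = 2 * k * s\<close> amounts to \<open>m = k * r\<close>,
    and coprimality of \<open>m\<close> and \<open>r\<close> then forces
    \<open>r = 1\<close>.\<close>
  have n_eq: "n = 2 * k * s \<longleftrightarrow> m = k \<and> r = 1" for k
  proof
    assume "n = 2 * k * s"
    then have "m * g = k * r * g"
      using mr by (metis mult.assoc mult.commute)
    then have "m = k * r"
      using g by simp
    then show "m = k \<and> r = 1"
      using mr(3) by simp
  next
    assume "m = k \<and> r = 1"
    then show "n = 2 * k * s"
      using mr(1,2) by simp
  qed
  show "subtopology N C homotopy_equivalent_space nsphere 3" if "n = 10 * s"
    unfolding component
    by (rule nsphere_arcs) (use \<phi> that n_eq[of 5] in simp)
  show "subtopology N C homotopy_equivalent_space wedge_of_spheres 2 2" if "n = 12 * s"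
    unfolding component
  proof (rule wedge_of_spheres_arcs_6)
    \<comment> \<open>The vertices of the graph end at \<open>n\<close>, so \<open>Suc n\<close> is
      free to be the auxiliary vertex.\<close>
    show "Suc n \<notin> range \<phi>"
    proof
      assume "Suc n \<in> range \<phi>"
      then obtain i where "rotation n s p i = Suc n"
        by (auto simp: \<phi>_def)
      then show False
        unfolding rotation_eq_iff[OF n] by simp
    qed
  qed (use \<phi> that n_eq[of 6] in simp)
  show "subtopology N C homotopy_equivalent_space wedge_of_spheres 1 1" if "n \<notin> {10 * s, 12 * s}"
    unfolding component
  proof (rule wedge_of_spheres_arcs[OF _ \<phi>])
    \<comment> \<open>For \<open>r \<ge> 2\<close> the inequality \<open>3 * r < m\<close> already
      gives \<open>m \<ge> 7\<close>; for \<open>r = 1\<close> it leaves exactly 4, 5 and 6 to be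
      ruled out.\<close>
    have "\<not> (m = 4 \<and> r = 1)" "\<not> (m = 5 \<and> r = 1)" "\<not> (m = 6 \<and> r = 1)"
      using that s(3) n_eq[of 4] n_eq[of 5] n_eq[of 6] by auto
    then show "m \<ge> 7"
      using m r by linarith
  qed
qed

lemma circulant_adj_commute: "circulant_adj n s t = circulant_adj n t s"
  by (auto simp: circulant_adj_def fun_eq_iff)

theorem theorem2p3:
  fixes n s t :: nat
  assumes "n \<ge> 5"
    and "s \<in> {1..n div 2}" and "t \<in> {1..n div 2}" and "s \<noteq> t"
    and "n \<notin> {2 * s, 2 * t, 2 * (s + t)}"
    and "3 * s = t \<or> 3 * t = s"
  defines "N \<equiv> geometric_realization
                  (neighborhood_complex (circulant_verts n) (circulant_adj n s t))"
  shows "\<forall>C \<in> connected_components_of N.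
     ((3 * s = t \<and> n = 10 * s) \<or> (3 * t = s \<and> n = 10 * t) \<longrightarrow>
        subtopology N C homotopy_equivalent_space nsphere 3) \<and>
     ((3 * s = t \<and> n = 12 * s) \<or> (3 * t = s \<and> n = 12 * t) \<longrightarrow>
        subtopology N C homotopy_equivalent_space wedge_of_spheres 2 2) \<and>
     ((3 * s = t \<and> n \<notin> {8 * s, 10 * s, 12 * s}) \<or>
      (3 * t = s \<and> n \<notin> {8 * t, 10 * t, 12 * t}) \<longrightarrow>
        (\<exists>k\<ge>1. subtopology N C homotopy_equivalent_space wedge_of_spheres 1 k))"
proof -
  define u where "u = min s t"
  \<comment> \<open>The larger of \<open>s\<close> and \<open>t\<close> is \<open>3 * u\<close>. It
    is at most \<open>n div 2\<close>, and \<open>n\<close> is not its double, whence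
    \<open>6 * u < n\<close>. As \<open>s + t = 4 * u\<close>, the third excluded value of
    \<open>n\<close> is \<open>8 * u\<close>.\<close>
  have u: "u \<ge> 1" "6 * u < n" "n \<noteq> 8 * u"
    using assms by (auto simp: u_def)
  have N: "N = geometric_realization
      (neighborhood_complex (circulant_verts n) (circulant_adj n u (3 * u)))"
    using assms(6) circulant_adj_commute[of n s t] by (auto simp: N_def u_def)
  have cases: "3 * s = t \<and> u = s \<or> 3 * t = s \<and> u = t" "\<not> (3 * s = t \<and> 3 * t = s)"
    using assms by (auto simp: u_def)
  note type = circulant_component_homotopy_type[OF u, folded N]
  show ?thesis
  proof (intro ballI conjI impI)
    fix C assume C: "C \<in> connected_components_of N"
    show "subtopology N C homotopy_equivalent_space nsphere 3"
      if "(3 * s = t \<and> n = 10 * s) \<or> (3 * t = s \<and> n = 10 * t)"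
      using type(1)[OF C] cases that by auto
    show "subtopology N C homotopy_equivalent_space wedge_of_spheres 2 2"
      if "(3 * s = t \<and> n = 12 * s) \<or> (3 * t = s \<and> n = 12 * t)"
      using type(2)[OF C] cases that by auto
    \<comment> \<open>The wedge always consists of a single circle, so the witness is 1.\<close>
    show "\<exists>k\<ge>1. subtopology N C homotopy_equivalent_space wedge_of_spheres 1 k"
      if "(3 * s = t \<and> n \<notin> {8 * s, 10 * s, 12 * s}) \<or> (3 * t = s \<and> n \<notin> {8 * t, 10 * t, 12 * t})"
      using type(3)[OF C] cases that by (intro exI[of _ 1]) auto
  qed
qed

end
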